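(* Let $k\ge 2$ be an integer and let $F=F_k\subset\mathbb{Z}\subset\mathbb{R}$ be the set of $k$th-power-free integers. Then the natural autocorrelation $\gamma$ of $F$ exists and is supported on $\mathbb{Z}$, i.e. $\gamma=\sum_{a\in\mathbb{Z}}w(a)\delta_a$, and for each $a\in\mathbb{Z}$ the weight of $a$ is $$w(a)=\xi(k)\prod_{p^k\mid a}\Bigl(1+\frac{1}{p^k-2}\Bigr),$$ with error term $O\bigl(R^{-(1-(1/k))^2}\bigr)$, that is, $$\Bigl|\,w(a)-\frac{1}{2R}\,\bigl|\{x\in F\mid x-a\in F,\ |x|<R,\ |x-a|<R\}\bigr|\,\Bigr|=O\bigl(R^{-(1-(1/k))^2}\bigr)\quad(R\to\infty),$$ where the implied constant depends on $a$.
   Context: $F_k$ is the set of integers not divisible by $d^k$ for any integer $d>1$. The product in $w(a)$ runs over all primes $p$ with $p^k\mid a$ (over all primes if $a=0$). $\xi(s)=\prod_p\bigl(1-\frac{2}{p^s}\bigr)$ for $\mathrm{Re}(s)>1$, the product over all primes. The natural autocorrelation of a uniformly discrete set $S\subset\mathbb{R}$ is $$\gamma=\lim_{R\to\infty}\frac{1}{2R}\sum_{x,y\in S,\ |x|,|y|<R}\delta_{x-y},$$ the limit taken in the weak*-topology on the space of tempered distributions (if it exists), where $\delta_x$ is the Dirac distribution at $x$. *)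

theory Defs
  imports "HOL-Analysis.Analysis" "HOL-Computational_Algebra.Primes"
begin

definition power_free :: "nat \<Rightarrow> int set" where
  "power_free k = {n. \<forall>d::int. d > 1 \<longrightarrow> \<not> d ^ k dvd n}"

definition xi :: "complex \<Rightarrow> complex" where
  "xi s = (\<Prod>n::nat. if prime n then 1 - 2 / of_nat n powr s else 1)"

text \<open>For nonzero \<open>a\<close> only finitely many factors differ from 1; for \<open>a = 0\<close> the
  divisibility condition always holds, so the product is over all primes.\<close>
definition weight :: "nat \<Rightarrow> int \<Rightarrow> complex" where
  "weight k a = xi (of_nat k) *
     (\<Prod>p::nat. if prime p \<and> int p ^ k dvd a then 1 + 1 / (of_nat p ^ k - 2) else 1)"

abbreviation nth_vderiv :: "nat \<Rightarrow> (real \<Rightarrow> complex) \<Rightarrow> real \<Rightarrow> complex" where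
  "nth_vderiv n \<phi> \<equiv> ((\<lambda>f x. vector_derivative f (at x)) ^^ n) \<phi>"

definition schwartz :: "(real \<Rightarrow> complex) set" where
  "schwartz = {\<phi>. (\<forall>n x. nth_vderiv n \<phi> differentiable (at x)) \<and>
     (\<forall>m n. bdd_above (range (\<lambda>x. \<bar>x\<bar> ^ m * cmod (nth_vderiv n \<phi> x))))}"

definition schwartz_seminorm :: "nat \<Rightarrow> nat \<Rightarrow> (real \<Rightarrow> complex) \<Rightarrow> real" where
  "schwartz_seminorm m n \<phi> = (SUP x. \<bar>x\<bar> ^ m * cmod (nth_vderiv n \<phi> x))"

definition schwartz_topology :: "(real \<Rightarrow> complex) topology" where
  "schwartz_topology = topology_generated_by
     {{\<psi> \<in> schwartz. schwartz_seminorm m n (\<lambda>x. \<psi> x - \<phi> x) < e} | m n \<phi> e.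
        \<phi> \<in> schwartz \<and> e > 0}"

text \<open>Functionals are taken to be extensional (\<open>undefined\<close> off \<^const>\<open>schwartz\<close>), so that
  equality of functionals on \<^const>\<open>schwartz\<close> is equality in HOL.\<close>
definition tempered_distributions :: "((real \<Rightarrow> complex) \<Rightarrow> complex) set" where
  "tempered_distributions = {T \<in> extensional schwartz.
     (\<forall>\<phi>\<in>schwartz. \<forall>\<psi>\<in>schwartz. T (\<lambda>x. \<phi> x + \<psi> x) = T \<phi> + T \<psi>) \<and>
     (\<forall>c. \<forall>\<phi>\<in>schwartz. T (\<lambda>x. c * \<phi> x) = c * T \<phi>) \<and>
     continuous_map schwartz_topology euclidean T}"

definition weak_star_topology :: "((real \<Rightarrow> complex) \<Rightarrow> complex) topology" where
  "weak_star_topology =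
     subtopology (product_topology (\<lambda>_. euclidean) schwartz) tempered_distributions"

definition dirac :: "real \<Rightarrow> (real \<Rightarrow> complex) \<Rightarrow> complex" where
  "dirac x = (\<lambda>\<phi>\<in>schwartz. \<phi> x)"

text \<open>The sums below are over finite sets when \<open>S\<close> is uniformly discrete.\<close>
definition truncated_autocorrelation :: "real set \<Rightarrow> real \<Rightarrow> (real \<Rightarrow> complex) \<Rightarrow> complex" where
  "truncated_autocorrelation S R = (\<lambda>\<phi>\<in>schwartz.
     1 / (2 * of_real R) *
       (\<Sum>x\<in>{x \<in> S. \<bar>x\<bar> < R}. \<Sum>y\<in>{y \<in> S. \<bar>y\<bar> < R}. dirac (x - y) \<phi>))"

definition has_natural_autocorrelation ::
  "real set \<Rightarrow> ((real \<Rightarrow> complex) \<Rightarrow> complex) \<Rightarrow> bool" where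
  "has_natural_autocorrelation S \<gamma> \<longleftrightarrow> uniform_discrete S \<and>
     limitin weak_star_topology (truncated_autocorrelation S) \<gamma> at_top"

end

theory Submission
  imports Defs "HOL-Computational_Algebra.Squarefree" "HOL-Number_Theory.Cong"
    "HOL-Real_Asymp.Real_Asymp"
begin

text \<open>
  Write \<open>N\<close> for the number of \<open>x\<close> with \<open>x\<close> and \<open>x - a\<close> both $k$th-power-free and both of absolute
  value below \<open>R\<close>. The double sum that defines the truncated autocorrelation, grouped by the
  difference \<open>a = x - y\<close>, has the weight $N/(2R)$ at \<open>a\<close>. So everything rests on the convergence
  of $N/(2R)$ to $w(a)$, and on its rate.

  \<^emph>\<open>The limit.\<close> The condition that no $p^k$ with \<open>p \<le> P\<close> divides \<open>x\<close> or \<open>x - a\<close> is periodic in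
  \<open>x\<close>. Conditions at different primes have coprime periods and are independent by the Chinese
  remainder theorem (\<open>card_periodic_inter\<close>), so the sieved integers have a density, the partial
  product of the Euler product of $w(a)$ over the primes up to \<open>P\<close>
  (\<open>sieve_density_tendsto_weight\<close>). The sieved integers that \<open>N\<close> does not count, apart from \<open>0\<close>
  and \<open>a\<close>, are such that \<open>x\<close> or \<open>x - a\<close> is a nonzero multiple of some $d^k$ with \<open>d > P\<close>; there
  are at most $4R P^{1-k}$ of them, uniformly in \<open>R\<close>. Letting first \<open>R\<close> and then \<open>P\<close> grow yields the
  limit (\<open>pair_frequency_tendsto_weight\<close>), but only a poor rate, since the period is
  exponential in \<open>P\<close>.

  \<^emph>\<open>The rate.\<close> For \<open>x \<noteq> 0\<close> the indicator of the $k$th-power-free integers is the sum of $\mu(d)$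
  over the \<open>d\<close> with $d^k \mid x$ (\<open>sum_moebius_kth_power_divisors\<close>). This expansion is used in full
  for \<open>x\<close>, where \<open>d\<close> is at most $R^{1/k}$, but it is cut at $e \le Y$ for \<open>x - a\<close>. The discarded
  \<open>e\<close> contribute at most $2R Y^{1-k}$, because the indicator in the other variable has been
  kept whole and is bounded by \<open>1\<close>. Each of the $R^{1/k} Y$ remaining pairs \<open>(d, e)\<close> prescribes a
  residue class or is contradictory, and costs an error $O(1)$. The two errors balance at
  $Y = R^{1/k - 1/k^2}$, where each is of order $R^{1-(1-1/k)^2}$ (\<open>pair_count_error\<close>).

  The main term is $2R$ times a finite double sum (\<open>density_sum\<close>). It converges with the same
  rate since for \<open>a \<noteq> 0\<close> compatible congruences have moduli whose greatest common divisor divides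
  \<open>a\<close> (\<open>joint_density_le\<close>, \<open>density_sum_cauchy\<close>). The value of the infinite double series is
  identified through $N/(2R)$, which has the same limit, already known to be $w(a)$
  (\<open>rate_from_cauchy_approximation\<close>). For \<open>a = 0\<close> both conditions coincide and the expansion
  in one variable gives the better exponent $1 - 1/k$.

  \<^emph>\<open>The autocorrelation.\<close> For \<open>R \<ge> 1\<close> the weights $N/(2R)$ are at most \<open>2\<close>, and a
  Schwartz function is bounded by a multiple of $1/(1+a^2)$. Hence all functionals with bounded weights on the integers are tempered, and limit and
  sum may be exchanged (\<open>lattice_distribution_tempered\<close>, \<open>lattice_distribution_tendsto\<close>).
\<close>

section \<open>Residue classes in intervals\<close>

lemma open_interval_int_eq:
  "{t::int. \<alpha> < real_of_int t \<and> real_of_int t < \<beta>} = {\<lfloor>\<alpha>\<rfloor> + 1..\<lceil>\<beta>\<rceil> - 1}"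
  by (auto simp: less_ceiling_iff floor_less_iff) linarith+

lemma card_open_interval_int:
  fixes \<alpha> \<beta> :: real
  assumes "\<alpha> \<le> \<beta>"
  shows "\<bar>real (card {t::int. \<alpha> < t \<and> t < \<beta>}) - (\<beta> - \<alpha>)\<bar> \<le> 1"
  unfolding open_interval_int_eq using assms by (simp add: abs_le_iff) linarith

lemma residue_class_eq_image:
  fixes q r :: int
  assumes "q > 0"
  shows "{x::int. u < real_of_int x \<and> real_of_int x < v \<and> q dvd x - r} =
    (\<lambda>t. r + q * t) ` {t::int. (u - r) / q < real_of_int t \<and> real_of_int t < (v - r) / q}"
proof -
  have "\<exists>t. x = r + q * t \<and> (u - r) / q < real_of_int t \<and> real_of_int t < (v - r) / q"
    if "u < real_of_int x" "real_of_int x < v" "q dvd x - r" for x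
  proof -
    from that(3) obtain t where "x - r = q * t" by auto
    then have "x = r + q * t" by simp
    with that assms show ?thesis by (intro exI[of _ t]) (auto simp: field_simps)
  qed
  with assms show ?thesis by (auto simp: image_iff field_simps)
qed

lemma card_residue_class_interval:
  fixes q r :: int and u v :: real
  assumes "u \<le> v" "q > 0"
  shows "\<bar>real (card {x::int. u < x \<and> x < v \<and> q dvd x - r}) - (v - u) / q\<bar> \<le> 1"
proof -
  have "inj_on (\<lambda>t. r + q * t) A" for A
    using assms by (auto simp: inj_on_def)
  then have "card {x::int. u < x \<and> x < v \<and> q dvd x - r} =
      card {t::int. (u - r) / q < t \<and> t < (v - r) / q}"
    unfolding residue_class_eq_image[OF assms(2)] by (rule card_image)
  moreover have "(v - u) / q = (v - r) / q - (u - r) / q"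
    by (simp add: diff_divide_distrib)
  moreover have "(u - r) / q \<le> (v - r) / q"
    using assms by (simp add: divide_right_mono)
  ultimately show ?thesis
    using card_open_interval_int by metis
qed

lemma finite_bounded_int [simp]: "finite {x::int. \<bar>real_of_int x\<bar> < R}"
proof -
  have "{x::int. \<bar>real_of_int x\<bar> < R} = {t::int. -R < real_of_int t \<and> real_of_int t < R}"
    by (auto simp: abs_less_iff)
  then show ?thesis by (simp only: open_interval_int_eq finite_atLeastAtMost_int)
qed

text \<open>Removing the multiple $0$ turns the error term $1$ into an inequality without
  error, so that the bound can be summed over arbitrarily many \<open>q\<close>.\<close>
lemma card_nonzero_multiples:
  fixes q :: int and R :: real
  assumes "R > 0" "q > 0"
  shows "real (card {x::int. x \<noteq> 0 \<and> \<bar>real_of_int x\<bar> < R \<and> q dvd x}) \<le> 2 * R / q"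
proof -
  let ?A = "{x::int. \<bar>real_of_int x\<bar> < R \<and> q dvd x}"
  have eq: "?A = {x::int. -R < x \<and> x < R \<and> q dvd x - 0}"
    by (auto simp: abs_less_iff)
  have "real (card ?A) \<le> 2 * R / q + 1"
    using card_residue_class_interval[of "-R" R q 0] assms unfolding eq by simp
  moreover have "card ?A = Suc (card (?A - {0}))"
  proof -
    have "finite ?A" by (rule finite_subset[OF _ finite_bounded_int[of R]]) auto
    moreover have "0 \<in> ?A" using assms by simp
    ultimately show ?thesis by (metis card_Suc_Diff1)
  qed
  moreover have "{x::int. x \<noteq> 0 \<and> \<bar>real_of_int x\<bar> < R \<and> q dvd x} = ?A - {0}"
    by auto
  ultimately show ?thesis by simp
qed

lemma card_nonzero_multiples_shift:
  fixes q a :: int and R :: real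
  assumes "R > 0" "q > 0"
  shows "real (card {x::int. x \<noteq> a \<and> \<bar>real_of_int (x - a)\<bar> < R \<and> q dvd x - a}) \<le> 2 * R / q"
proof -
  have "{x::int. x \<noteq> a \<and> \<bar>real_of_int (x - a)\<bar> < R \<and> q dvd x - a} =
      (\<lambda>x. x + a) ` {x::int. x \<noteq> 0 \<and> \<bar>real_of_int x\<bar> < R \<and> q dvd x}"
  proof (intro equalityI subsetI)
    fix x assume "x \<in> {x::int. x \<noteq> a \<and> \<bar>real_of_int (x - a)\<bar> < R \<and> q dvd x - a}"
    then show "x \<in> (\<lambda>x. x + a) ` {x::int. x \<noteq> 0 \<and> \<bar>real_of_int x\<bar> < R \<and> q dvd x}"
      by (intro image_eqI[of _ _ "x - a"]) auto
  qed auto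
  then show ?thesis
    using card_nonzero_multiples[OF assms] by (simp add: card_image)
qed

section \<open>The Moebius expansion of the indicator of the power-free integers\<close>

definition moebius_mu :: "nat \<Rightarrow> real" where
  "moebius_mu d = (if squarefree d then (-1) ^ card (prime_factors d) else 0)"

lemma abs_moebius_mu_le_1: "\<bar>moebius_mu d\<bar> \<le> 1"
  by (simp add: moebius_mu_def power_abs)

lemma moebius_mu_1 [simp]: "moebius_mu (Suc 0) = 1"
  by (simp add: moebius_mu_def)

lemma power_free_iff_prime:
  assumes "k > 0"
  shows "x \<in> power_free k \<longleftrightarrow> (\<forall>p::nat. prime p \<longrightarrow> \<not> int p ^ k dvd x)"
proof
  assume "x \<in> power_free k"
  then show "\<forall>p::nat. prime p \<longrightarrow> \<not> int p ^ k dvd x"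
    unfolding power_free_def using prime_gt_1_nat by fastforce
next
  assume *: "\<forall>p::nat. prime p \<longrightarrow> \<not> int p ^ k dvd x"
  have "\<not> d ^ k dvd x" if "d > 1" for d :: int
  proof
    assume "d ^ k dvd x"
    have "nat d \<noteq> 1" using that by auto
    then obtain p where p: "prime p" "p dvd nat d"
      using prime_factor_nat by blast
    then have "int p dvd d" using that 
      by (simp add: int_dvd_int_iff[symmetric] del: int_dvd_int_iff)
    then have "int p ^ k dvd x"
      using \<open>d ^ k dvd x\<close> dvd_power_same dvd_trans by blast
    with * p show False by blast
  qed
  then show "x \<in> power_free k" by (simp add: power_free_def)
qed

lemma finite_kth_power_divisors:
  assumes "x \<noteq> 0" "k > 0"
  shows "finite {d::nat. int d ^ k dvd x}"
proof (rule finite_subset)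
  show "{d::nat. int d ^ k dvd x} \<subseteq> {..nat \<bar>x\<bar>}"
  proof
    fix d assume "d \<in> {d::nat. int d ^ k dvd x}"
    then have "int d ^ k \<le> \<bar>x\<bar>"
      using dvd_imp_le_int[of x "int d ^ k"] assms by simp
    moreover have "int d \<le> int d ^ k"
      using assms by (cases "d = 0") (auto intro: self_le_power)
    ultimately have "int d \<le> \<bar>x\<bar>" by (rule order_trans[rotated])
    then show "d \<in> {..nat \<bar>x\<bar>}" by simp
  qed
qed auto

text \<open>Together with the next lemma: finite sets of primes correspond to square-free numbers.\<close>
lemma squarefree_prod_primes:
  assumes "finite S" "\<And>p. p \<in> S \<Longrightarrow> prime (p::nat)"
  shows "squarefree (\<Prod>S)" "prime_factors (\<Prod>S) = S"
proof -
  show "squarefree (\<Prod>S)"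
    by (rule squarefree_prod_coprime) (auto intro: squarefree_prime assms primes_coprime)
  show "prime_factors (\<Prod>S) = S"
    using assms
  proof (induction S)
    case (insert p S)
    then have "prime p" "\<And>q. q \<in> insert p S \<Longrightarrow> q \<noteq> 0"
      by (auto simp: prime_gt_0_nat)
    then have "p \<noteq> 0" "\<Prod>S \<noteq> 0" "prime p"
      using insert.hyps by auto
    then show ?case
      using insert prime_factors_product[of p "\<Prod>S"] by (simp add: prime_prime_factors prime_gt_0_nat)
  qed auto
qed

lemma prod_prime_factors_squarefree:
  assumes "squarefree (d::nat)"
  shows "\<Prod>(prime_factors d) = d"
proof -
  have "d \<noteq> 0" using assms by (metis not_squarefree_0)
  then have "d = (\<Prod>p\<in>prime_factors d. p ^ multiplicity p d)"
    by (intro prime_factorization_nat) simp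
  also have "\<dots> = (\<Prod>p\<in>prime_factors d. p)"
    using assms squarefree_factorial_semiring'[OF \<open>d \<noteq> 0\<close>] by (intro prod.cong) auto
  finally show ?thesis by simp
qed

lemma prod_primes_power_dvd:
  fixes x :: int
  assumes "finite S" "\<And>p. p \<in> S \<Longrightarrow> prime (p::nat)" "\<And>p. p \<in> S \<Longrightarrow> int p ^ k dvd x"
  shows "int (\<Prod>S) ^ k dvd x"
  using assms
proof (induction S)
  case (insert p S)
  have "coprime p (\<Prod>S)"
    using insert.hyps insert.prems(1) by (intro prod_coprime_right primes_coprime) auto
  then have "coprime (int p ^ k) (int (\<Prod>S) ^ k)"
    by (metis coprime_int_iff coprime_power_left_iff coprime_power_right_iff)
  then show ?case
    using insert by (simp add: power_mult_distrib divides_mult)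
qed auto

text \<open>The square-free \<open>d\<close> with $d^k \mid x$ are the products of the subsets of the set
  of primes \<open>p\<close> with $p^k \mid x$; the alternating sum over the subsets of a finite set
  vanishes unless that set is empty.\<close>
lemma sum_moebius_kth_power_divisors:
  assumes "x \<noteq> 0" "k > 0"
  shows "(\<Sum>d | int d ^ k dvd x. moebius_mu d) = of_bool (x \<in> power_free k)"
proof -
  define T where "T = {p::nat. prime p \<and> int p ^ k dvd x}"
  have fin: "finite T"
    by (rule finite_subset[OF _ finite_kth_power_divisors[OF assms]]) (auto simp: T_def)
  have finS: "finite S" if "S \<subseteq> T" for S using that fin by (rule finite_subset)
  have "(\<Sum>d | int d ^ k dvd x. moebius_mu d) = (\<Sum>d | squarefree d \<and> int d ^ k dvd x. moebius_mu d)"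
    by (rule sum.mono_neutral_right) (use finite_kth_power_divisors[OF assms] in \<open>auto simp: moebius_mu_def\<close>)
  also have "\<dots> = (\<Sum>S\<in>Pow T. (-1) ^ card S)"
  proof (rule sum.reindex_bij_witness[of _ "\<lambda>S. \<Prod>S" prime_factors])
    fix d assume d: "d \<in> {d. squarefree d \<and> int d ^ k dvd x}"
    then show "\<Prod>(prime_factors d) = d" by (simp add: prod_prime_factors_squarefree)
    show "prime_factors d \<in> Pow T"
      using d by (auto simp: T_def) (meson dvd_power_same dvd_trans int_dvd_int_iff in_prime_factors_imp_dvd)
    show "(-1) ^ card (prime_factors d) = moebius_mu d"
      using d by (simp add: moebius_mu_def)
  next
    fix S assume S: "S \<in> Pow T"
    then have S': "finite S" "\<And>p. p \<in> S \<Longrightarrow> prime p" "\<And>p. p \<in> S \<Longrightarrow> int p ^ k dvd x"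
      using finS by (auto simp: T_def)
    show "prime_factors (\<Prod>S) = S" by (rule squarefree_prod_primes) (use S' in auto)
    show "\<Prod>S \<in> {d. squarefree d \<and> int d ^ k dvd x}"
      using squarefree_prod_primes(1)[OF S'(1,2)] prod_primes_power_dvd[OF S'] by simp
  qed
  also have "\<dots> = (\<Prod>p\<in>T. 1 - 1)"
    using prod_diff_conv_sum[OF fin, of "\<lambda>_. 1" "\<lambda>_. 1::real"] by simp
  also have "\<dots> = of_bool (T = {})"
    using fin by auto
  also have "T = {} \<longleftrightarrow> x \<in> power_free k"
    using power_free_iff_prime[OF assms(2)] by (auto simp: T_def)
  finally show ?thesis .
qed

section \<open>The sieve by finitely many primes\<close>

definition periodic :: "int \<Rightarrow> int set \<Rightarrow> bool" where
  "periodic M A \<longleftrightarrow> (\<forall>x y. M dvd x - y \<longrightarrow> (x \<in> A \<longleftrightarrow> y \<in> A))"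

lemma periodicD: "periodic M A \<Longrightarrow> M dvd x - y \<Longrightarrow> x \<in> A \<longleftrightarrow> y \<in> A"
  unfolding periodic_def by blast

lemma periodic_mod: "periodic M A \<Longrightarrow> x mod M \<in> A \<longleftrightarrow> x \<in> A"
  by (rule periodicD) (auto simp: mod_eq_dvd_iff[symmetric])

text \<open>A periodic set is a disjoint union of at most \<open>M\<close> residue classes, each of which is counted
  with an error of at most \<open>1\<close>.\<close>
lemma card_periodic_interval:
  fixes u v :: real
  assumes "periodic M A" "M > 0" "u \<le> v"
  shows "\<bar>real (card {x\<in>A. u < real_of_int x \<and> real_of_int x < v}) -
           (v - u) * (card ({0..<M} \<inter> A) / M)\<bar> \<le> M"
proof -
  define C where "C = (\<lambda>r. {x::int. u < real_of_int x \<and> real_of_int x < v \<and> M dvd x - r})"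
  have fin: "finite {x::int. u < real_of_int x \<and> real_of_int x < v}"
    unfolding open_interval_int_eq by simp
  have "{x\<in>A. u < real_of_int x \<and> real_of_int x < v} = (\<Union>r\<in>{0..<M} \<inter> A. C r)"
  proof (intro equalityI subsetI)
    fix x assume x: "x \<in> {x\<in>A. u < real_of_int x \<and> real_of_int x < v}"
    then have "x mod M \<in> {0..<M} \<inter> A" "x \<in> C (x mod M)"
      using assms by (auto simp: C_def periodic_mod mod_eq_dvd_iff[symmetric])
    then show "x \<in> (\<Union>r\<in>{0..<M} \<inter> A. C r)" by blast
  qed (use periodicD[OF assms(1)] in \<open>auto simp: C_def\<close>)
  then have "card {x\<in>A. u < real_of_int x \<and> real_of_int x < v} = card (\<Union>r\<in>{0..<M} \<inter> A. C r)"
    by simp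
  also have "\<dots> = (\<Sum>r\<in>{0..<M} \<inter> A. card (C r))"
  proof (rule card_UN_disjoint)
    show "\<forall>r\<in>{0..<M} \<inter> A. finite (C r)"
      by (auto simp: C_def intro!: finite_subset[OF _ fin])
    show "\<forall>r\<in>{0..<M} \<inter> A. \<forall>s\<in>{0..<M} \<inter> A. r \<noteq> s \<longrightarrow> C r \<inter> C s = {}"
    proof (intro ballI impI)
      fix r s assume *: "r \<in> {0..<M} \<inter> A" "s \<in> {0..<M} \<inter> A" "r \<noteq> s"
      have False if "M dvd x - r" "M dvd x - s" for x
      proof -
        have "x mod M = r mod M" "x mod M = s mod M"
          using that by (auto simp: mod_eq_dvd_iff)
        with * show False by auto
      qed
      then show "C r \<inter> C s = {}" by (auto simp: C_def)
    qed
  qed auto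
  finally have "real (card {x\<in>A. u < real_of_int x \<and> real_of_int x < v}) -
      (v - u) * (card ({0..<M} \<inter> A) / M) = (\<Sum>r\<in>{0..<M} \<inter> A. (real (card (C r)) - (v - u) / M))"
    by (simp add: sum_subtractf)
  also have "\<bar>\<dots>\<bar> \<le> (\<Sum>r\<in>{0..<M} \<inter> A. \<bar>real (card (C r)) - (v - u) / M\<bar>)"
    by (rule sum_abs)
  also have "\<dots> \<le> (\<Sum>r\<in>{0..<M} \<inter> A. 1)"
    unfolding C_def by (rule sum_mono) (rule card_residue_class_interval[OF assms(3,2)])
  also have "\<dots> = real (card ({0..<M} \<inter> A))" by simp
  also have "\<dots> \<le> real (card {0..<M})"
    by (intro of_nat_mono card_mono) auto
  also have "\<dots> = M" using assms by simp
  finally show ?thesis .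
qed

text \<open>By the Chinese remainder theorem, reduction modulo \<open>M\<close> and modulo \<open>N\<close> is a bijection
  from the residues modulo \<open>M * N\<close> to pairs of residues: conditions with coprime periods
  are independent.\<close>
lemma card_periodic_inter:
  assumes "periodic M A" "periodic N B" "M > 0" "N > 0" "coprime M N"
  shows "periodic (M * N) (A \<inter> B)"
    "card ({0..<M * N} \<inter> (A \<inter> B)) = card ({0..<M} \<inter> A) * card ({0..<N} \<inter> B)"
proof -
  show "periodic (M * N) (A \<inter> B)"
    using periodicD[OF assms(1)] periodicD[OF assms(2)] unfolding periodic_def
    by (meson IntD1 IntD2 IntI dvd_mult_left dvd_mult_right)
  let ?f = "\<lambda>x. (x mod M, x mod N)"
  have "bij_betw ?f ({0..<M * N} \<inter> (A \<inter> B)) (({0..<M} \<inter> A) \<times> ({0..<N} \<inter> B))"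
  proof (rule bij_betwI')
    fix x y assume xy: "x \<in> {0..<M * N} \<inter> (A \<inter> B)" "y \<in> {0..<M * N} \<inter> (A \<inter> B)"
    show "?f x = ?f y \<longleftrightarrow> x = y"
    proof
      assume "?f x = ?f y"
      then have "M dvd x - y" "N dvd x - y" by (auto simp: mod_eq_dvd_iff)
      then have "M * N dvd x - y" using assms(5) by (rule divides_mult)
      then have "x mod (M * N) = y mod (M * N)" by (simp add: mod_eq_dvd_iff)
      with xy show "x = y" by simp
    qed simp
  next
    fix x assume "x \<in> {0..<M * N} \<inter> (A \<inter> B)"
    then show "?f x \<in> ({0..<M} \<inter> A) \<times> ({0..<N} \<inter> B)"
      using assms by (auto simp: periodic_mod)
  next
    fix z assume "z \<in> ({0..<M} \<inter> A) \<times> ({0..<N} \<inter> B)"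
    then obtain r s where z: "z = (r, s)" and r: "r \<in> {0..<M} \<inter> A" and s: "s \<in> {0..<N} \<inter> B"
      by auto
    obtain x where x: "[x = r] (mod M)" "[x = s] (mod N)"
      using binary_chinese_remainder_int[OF assms(5)] by blast
    define y where "y = x mod (M * N)"
    have y: "y mod M = r" "y mod N = s"
      using x r s unfolding y_def cong_def by (auto simp: mod_mod_cancel)
    have "y \<in> A" "y \<in> B"
      using periodic_mod[OF assms(1), of y] periodic_mod[OF assms(2), of y] r s y by auto
    then have "y \<in> {0..<M * N} \<inter> (A \<inter> B)"
      using assms by (auto simp: y_def)
    with y z show "\<exists>x\<in>{0..<M * N} \<inter> (A \<inter> B). z = ?f x"
      by (intro bexI[of _ y]) auto
  qed
  then show "card ({0..<M * N} \<inter> (A \<inter> B)) = card ({0..<M} \<inter> A) * card ({0..<N} \<inter> B)"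
    by (simp add: bij_betw_same_card card_cartesian_product)
qed

definition excluded_residues :: "nat \<Rightarrow> int \<Rightarrow> nat \<Rightarrow> nat" where
  "excluded_residues k a p = (if int p ^ k dvd a then 1 else 2)"

lemma card_avoiding_two_residues:
  assumes "q > 1"
  shows "card ({0..<q} \<inter> {x::int. \<not> q dvd x \<and> \<not> q dvd x - a}) = nat q - (if q dvd a then 1 else 2)"
proof -
  have "{0..<q} \<inter> {x::int. \<not> q dvd x \<and> \<not> q dvd x - a} = {0..<q} - {0, a mod q}"
  proof -
    have "q dvd x \<longleftrightarrow> x = 0" "q dvd x - a \<longleftrightarrow> x = a mod q" if "x \<in> {0..<q}" for x
      using that by (auto simp: zdvd_not_zless mod_eq_dvd_iff[symmetric]) 
        (metis atLeastLessThan_iff dvd_0_right mod_0_imp_dvd mod_pos_pos_trivial dvd_imp_mod_0 that)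
    then show ?thesis by auto
  qed
  also have "card \<dots> = card {0..<q} - card {0, a mod q}"
    using assms by (intro card_Diff_subset) auto
  also have "card {0, a mod q} = (if q dvd a then 1 else 2)"
    by (auto simp: dvd_eq_mod_eq_0)
  finally show ?thesis by simp
qed

definition sieved :: "nat \<Rightarrow> int \<Rightarrow> nat set \<Rightarrow> int set" where
  "sieved k a S = {x. \<forall>p\<in>S. \<not> int p ^ k dvd x \<and> \<not> int p ^ k dvd x - a}"

definition sieve_density :: "nat \<Rightarrow> int \<Rightarrow> nat set \<Rightarrow> real" where
  "sieve_density k a S = (\<Prod>p\<in>S. 1 - excluded_residues k a p / real p ^ k)"

lemma prime_power_ge_4:
  assumes "prime (p::nat)" "k \<ge> 2"
  shows "p ^ k \<ge> 4"
proof -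
  have "(2::nat) ^ 2 \<le> 2 ^ k" using assms by (intro power_increasing) auto
  also have "\<dots> \<le> p ^ k" using assms prime_ge_2_nat by (intro power_mono) auto
  finally show ?thesis by simp
qed

text \<open>Induction over the primes: each new prime contributes an independent condition with a
  coprime period.\<close>
lemma sieved_residues:
  assumes "k \<ge> 2" "finite S" "\<And>p. p \<in> S \<Longrightarrow> prime p"
  shows "periodic (\<Prod>p\<in>S. int p ^ k) (sieved k a S) \<and>
    card ({0..<\<Prod>p\<in>S. int p ^ k} \<inter> sieved k a S) = (\<Prod>p\<in>S. p ^ k - excluded_residues k a p)"
  using assms(2,3)
proof (induction S)
  case empty
  then show ?case by (auto simp: periodic_def sieved_def)
next
  case (insert p S)
  let ?q = "int p ^ k"
  let ?A = "{x::int. \<not> ?q dvd x \<and> \<not> ?q dvd x - a}"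
  let ?N = "\<Prod>p\<in>S. int p ^ k"
  have p: "prime p" "\<And>p. p \<in> S \<Longrightarrow> prime p" using insert by auto
  have q: "?q > 1" 
    using prime_power_ge_4[OF p(1) assms(1)] by (simp flip: of_nat_power)
  have A: "periodic ?q ?A"
    unfolding periodic_def
  proof (intro allI impI)
    fix x y assume "?q dvd x - y"
    then have "x mod ?q = y mod ?q" by (simp add: mod_eq_dvd_iff)
    moreover from this have "(x - a) mod ?q = (y - a) mod ?q" by (metis mod_diff_left_eq)
    ultimately have "?q dvd x \<longleftrightarrow> ?q dvd y" "?q dvd x - a \<longleftrightarrow> ?q dvd y - a"
      by (simp_all add: dvd_eq_mod_eq_0)
    then show "x \<in> ?A \<longleftrightarrow> y \<in> ?A" by simp
  qed
  have N: "?N > 0" using p by (intro prod_pos) (auto simp: prime_gt_0_nat)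
  have cop: "coprime ?q ?N"
    using p insert.hyps by (intro prod_coprime_right) (auto simp: intro!: primes_coprime)
  have eq: "sieved k a (insert p S) = ?A \<inter> sieved k a S" by (auto simp: sieved_def)
  have IH: "periodic ?N (sieved k a S)"
    "card ({0..<?N} \<inter> sieved k a S) = (\<Prod>p\<in>S. p ^ k - excluded_residues k a p)"
    using insert.IH p(2) by auto
  have "card ({0..<?q} \<inter> ?A) = p ^ k - excluded_residues k a p"
    using card_avoiding_two_residues[OF q, of a] by (simp add: excluded_residues_def nat_power_eq)
  with card_periodic_inter[OF A IH(1) _ N cop] IH(2) q eq show ?case
    using insert.hyps p(1) by (simp add: prime_gt_0_nat)
qed

lemma excluded_residues_le:
  assumes "k \<ge> 2" "prime p"
  shows "excluded_residues k a p \<le> p ^ k"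
  using prime_power_ge_4[OF assms(2,1)] by (simp add: excluded_residues_def)

lemma sieve_density_eq:
  assumes "k \<ge> 2" "finite S" "\<And>p. p \<in> S \<Longrightarrow> prime p"
  shows "card ({0..<\<Prod>p\<in>S. int p ^ k} \<inter> sieved k a S) / (\<Prod>p\<in>S. int p ^ k) = sieve_density k a S"
proof -
  have "card ({0..<\<Prod>p\<in>S. int p ^ k} \<inter> sieved k a S) / (\<Prod>p\<in>S. int p ^ k) =
      (\<Prod>p\<in>S. real (p ^ k - excluded_residues k a p) / real p ^ k)"
    using sieved_residues[OF assms] by (simp add: prod_dividef)
  also have "\<dots> = sieve_density k a S"
    unfolding sieve_density_def
  proof (rule prod.cong)
    fix p assume "p \<in> S"
    then have "prime p" using assms by auto
    then show "real (p ^ k - excluded_residues k a p) / real p ^ k = 1 - excluded_residues k a p / real p ^ k"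
      using excluded_residues_le[OF assms(1), of p a] by (simp add: of_nat_diff field_simps prime_gt_0_nat)
  qed simp
  finally show ?thesis .
qed

lemma sieve_density_bounds:
  assumes "k \<ge> 2" "\<And>p. p \<in> S \<Longrightarrow> prime p"
  shows "0 \<le> sieve_density k a S" "sieve_density k a S \<le> 1"
proof -
  have "0 \<le> 1 - excluded_residues k a p / real p ^ k \<and> 1 - excluded_residues k a p / real p ^ k \<le> 1"
    if "p \<in> S" for p
  proof -
    have "real (excluded_residues k a p) \<le> real p ^ k"
      using excluded_residues_le[OF assms(1), of p a] assms(2)[OF that] by (metis of_nat_le_iff of_nat_power)
    then show ?thesis using assms(2)[OF that] by (simp add: prime_gt_0_nat)
  qed
  then show "0 \<le> sieve_density k a S" "sieve_density k a S \<le> 1"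
    unfolding sieve_density_def by (auto intro!: prod_nonneg prod_le_1)
qed

text \<open>The two conditions \<open>\<bar>x\<bar> < R\<close> and \<open>\<bar>x - a\<bar> < R\<close> define an open interval, shorter than \<open>2 * R\<close> by
  \<open>\<bar>a\<bar>\<close>; this difference only affects the error terms.\<close>
lemma window_eq:
  "\<bar>real_of_int x\<bar> < R \<and> \<bar>real_of_int (x - a)\<bar> < R \<longleftrightarrow>
   max (-R) (a - R) < real_of_int x \<and> real_of_int x < min R (a + R)"
  by auto

lemma window_length: "min R (a + R) - max (-R) (a - R) = 2 * R - \<bar>a::real\<bar>"
  by (auto simp: min_def max_def)

lemma card_sieved_window:
  assumes "k \<ge> 2" "finite S" "\<And>p. p \<in> S \<Longrightarrow> prime p" "2 * R \<ge> \<bar>real_of_int a\<bar>"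
  shows "\<bar>real (card {x\<in>sieved k a S. \<bar>real_of_int x\<bar> < R \<and> \<bar>real_of_int (x - a)\<bar> < R}) -
    2 * R * sieve_density k a S\<bar> \<le> (\<Prod>p\<in>S. int p ^ k) + \<bar>real_of_int a\<bar>"
proof -
  let ?M = "\<Prod>p\<in>S. int p ^ k"
  have M: "?M > 0" using assms by (intro prod_pos) (auto simp: prime_gt_0_nat)
  have "\<bar>real (card {x\<in>sieved k a S. \<bar>real_of_int x\<bar> < R \<and> \<bar>real_of_int (x - a)\<bar> < R}) -
    (2 * R - \<bar>real_of_int a\<bar>) * sieve_density k a S\<bar> \<le> ?M"
  proof -
    have "max (-R) (a - R) \<le> min R (a + R)"
      using window_length[of R a] assms(4) by linarith
    moreover have "periodic ?M (sieved k a S)"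
      using sieved_residues[OF assms(1,2)] assms(3) by blast
    moreover have "card ({0..<?M} \<inter> sieved k a S) / ?M = sieve_density k a S"
      using sieve_density_eq[OF assms(1,2)] assms(3) by blast
    ultimately show ?thesis
      using card_periodic_interval[of ?M "sieved k a S" "max (-R) (a - R)" "min R (a + R)"] M
      by (simp only: window_eq window_length)
  qed
  moreover have "\<bar>\<bar>real_of_int a\<bar> * sieve_density k a S\<bar> \<le> \<bar>real_of_int a\<bar>"
    using sieve_density_bounds[OF assms(1,3), of S a] by (simp add: abs_mult mult_left_le)
  ultimately show ?thesis
    unfolding left_diff_distrib by linarith
qed

section \<open>Convergence of the pair frequencies to the weights\<close>

text \<open>This is \<open>1 / (x + 1) ^ (m + 2) \<le> 1 / x ^ (m + 1) - 1 / (x + 1) ^ (m + 1)\<close> without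
  denominators.\<close>
lemma telescoping_power_bound:
  fixes x :: real
  assumes "x \<ge> 0"
  shows "(x + 2) * x ^ Suc m \<le> (x + 1) ^ Suc (Suc m)"
proof (induction m)
  case 0
  show ?case by (simp add: power2_eq_square algebra_simps)
next
  case (Suc m)
  have "(x + 2) * x ^ Suc (Suc m) = ((x + 2) * x ^ Suc m) * x" by simp
  also have "\<dots> \<le> (x + 1) ^ Suc (Suc m) * (x + 1)"
    using Suc assms by (intro mult_mono) auto
  finally show ?case by (simp add: mult_ac)
qed

text \<open>The summand is dominated by the telescoping difference
  $(d-1)^{-(k-1)} - d^{-(k-1)}$.\<close>
lemma sum_inverse_powers_tail:
  assumes "k \<ge> 2" "P \<ge> 1"
  shows "(\<Sum>d\<in>{P<..D}. 1 / real d ^ k) \<le> 1 / real P ^ (k - 1)"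
proof -
  obtain m where k: "k = Suc (Suc m)"
    using assms le_Suc_ex[of 2 k] by auto
  have "(\<Sum>d\<in>{P<..D}. 1 / real d ^ k) \<le> 1 / real P ^ (k - 1) - 1 / real D ^ (k - 1)" if "D \<ge> P"
    using that
  proof (induction D rule: dec_induct)
    case (step D)
    define x where "x = real D"
    have x: "x \<ge> 1" using step assms by (simp add: x_def)
    have "(x + 2) / (x + 1) ^ Suc (Suc m) \<le> 1 / x ^ Suc m"
      using telescoping_power_bound[of x m] x by (simp add: divide_simps del: power_Suc)
    moreover have "(x + 2) / (x + 1) ^ Suc (Suc m) = 1 / (x + 1) ^ Suc m + 1 / (x + 1) ^ Suc (Suc m)"
      using x by (simp add: divide_simps)
    ultimately have "1 / real (Suc D) ^ k \<le> 1 / real D ^ (k - 1) - 1 / real (Suc D) ^ (k - 1)"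
      by (simp add: k x_def add.commute del: power_Suc)
    moreover have "{P<..Suc D} = insert (Suc D) {P<..D}" using step by auto
    ultimately show ?case using step by simp
  qed simp
  moreover have "0 \<le> 1 / real D ^ (k - 1)" by simp
  ultimately show ?thesis
    by (cases "D \<ge> P") (auto intro: order_trans)
qed

definition pair_window :: "nat \<Rightarrow> int \<Rightarrow> real \<Rightarrow> int set" where
  "pair_window k a R = {x \<in> power_free k. x - a \<in> power_free k \<and>
     \<bar>real_of_int x\<bar> < R \<and> \<bar>real_of_int (x - a)\<bar> < R}"

lemma finite_pair_window [simp]: "finite (pair_window k a R)"
  by (rule finite_subset[OF _ finite_bounded_int[of R]]) (auto simp: pair_window_def)

lemma kth_power_divisor_bound:
  assumes "x \<noteq> 0" "k > 0" "\<bar>real_of_int x\<bar> < R" "int d ^ k dvd x"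
  shows "real d ^ k < R"
proof -
  have "int d ^ k \<le> \<bar>x\<bar>"
    using dvd_imp_le_int[of x "int d ^ k"] assms by simp
  then have "real d ^ k \<le> \<bar>real_of_int x\<bar>"
    by (metis of_int_abs of_int_le_iff of_int_of_nat_eq of_int_power)
  with assms show ?thesis by simp
qed

lemma divisor_le_of_power_lt:
  assumes "k > 0" "real d ^ k < R"
  shows "d \<le> nat \<lceil>R\<rceil>"
proof -
  have "real d \<le> real d ^ k"
    using assms by (cases "d = 0") (auto intro: self_le_power)
  with assms have "real d \<le> R" by linarith
  then show ?thesis by linarith
qed

lemma card_large_power_divisors:
  assumes "k \<ge> 2" "P \<ge> 1" "R > 0"
  shows "real (card (\<Union>d\<in>{P<..D}. {x::int. x \<noteq> a \<and> \<bar>real_of_int (x - a)\<bar> < R \<and> int d ^ k dvd x - a}))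
    \<le> 2 * R / real P ^ (k - 1)"
proof -
  let ?B = "\<lambda>d. {x::int. x \<noteq> a \<and> \<bar>real_of_int (x - a)\<bar> < R \<and> int d ^ k dvd x - a}"
  have "real (card (\<Union>d\<in>{P<..D}. ?B d)) \<le> real (\<Sum>d\<in>{P<..D}. card (?B d))"
    by (intro of_nat_mono card_UN_le) simp
  also have "\<dots> \<le> (\<Sum>d\<in>{P<..D}. 2 * R * (1 / real d ^ k))"
    unfolding of_nat_sum
  proof (rule sum_mono)
    fix d assume "d \<in> {P<..D}"
    then have "int d ^ k > 0" by simp
    from card_nonzero_multiples_shift[OF assms(3) this, of a]
    show "real (card (?B d)) \<le> 2 * R * (1 / real d ^ k)" by simp
  qed
  also have "\<dots> \<le> 2 * R * (1 / real P ^ (k - 1))"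
    unfolding sum_distrib_left[symmetric]
    using sum_inverse_powers_tail[OF assms(1,2)] assms(3) by (intro mult_left_mono) auto
  finally show ?thesis by simp
qed

lemma finite_shifted_window [simp]: "finite {x::int. \<bar>real_of_int (x - a)\<bar> < R}"
proof -
  have "{x::int. \<bar>real_of_int (x - a)\<bar> < R} \<subseteq> (\<lambda>x. x + a) ` {x::int. \<bar>real_of_int x\<bar> < R}"
  proof
    fix x assume "x \<in> {x::int. \<bar>real_of_int (x - a)\<bar> < R}"
    then show "x \<in> (\<lambda>x. x + a) ` {x::int. \<bar>real_of_int x\<bar> < R}"
      by (intro image_eqI[of _ _ "x - a"]) auto
  qed
  then show ?thesis by (rule finite_subset) simp
qed

text \<open>An integer that survives the sieve by the primes up to \<open>P\<close> and is not counted is \<open>0\<close>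
  or \<open>a\<close>, or it or its shift is a nonzero multiple of some $d^k$ with \<open>d > P\<close>.\<close>
lemma card_sieved_le_pair_window:
  assumes "k \<ge> 2" "P \<ge> 1" "R > 0"
  defines "S \<equiv> {p. prime p \<and> p \<le> P}"
  shows "real (card {x\<in>sieved k a S. \<bar>real_of_int x\<bar> < R \<and> \<bar>real_of_int (x - a)\<bar> < R})
    \<le> card (pair_window k a R) + 2 + 4 * R / real P ^ (k - 1)"
proof -
  define D where "D = nat \<lceil>R\<rceil>"
  define U where "U = (\<lambda>b. \<Union>d\<in>{P<..D}. {x::int. x \<noteq> b \<and> \<bar>real_of_int (x - b)\<bar> < R \<and> int d ^ k dvd x - b})"
  have fU: "finite (U b)" for b
    unfolding U_def by (intro finite_UN_I finite_subset[OF _ finite_shifted_window[of b R]]) auto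
  have cover: "x - b \<in> power_free k \<or> x = b \<or> x \<in> U b"
    if "\<And>p. p \<in> S \<Longrightarrow> \<not> int p ^ k dvd x - b" "\<bar>real_of_int (x - b)\<bar> < R" for x b
  proof (cases "x - b \<in> power_free k \<or> x = b")
    case False
    then obtain p where p: "prime p" "int p ^ k dvd x - b"
      using power_free_iff_prime[of k "x - b"] assms(1) by auto
    then have "p \<notin> S" using that(1) by blast
    with p have "p > P" by (simp add: S_def)
    moreover have "p \<le> D" unfolding D_def
      by (rule divisor_le_of_power_lt[OF _ kth_power_divisor_bound])
        (use False p that assms in auto)
    ultimately show ?thesis using False p that(2) by (auto simp: U_def)
  qed auto
  have "{x\<in>sieved k a S. \<bar>real_of_int x\<bar> < R \<and> \<bar>real_of_int (x - a)\<bar> < R} \<subseteq>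
      pair_window k a R \<union> ({0, a} \<union> (U 0 \<union> U a))"
  proof
    fix x assume x: "x \<in> {x\<in>sieved k a S. \<bar>real_of_int x\<bar> < R \<and> \<bar>real_of_int (x - a)\<bar> < R}"
    have "x - 0 \<in> power_free k \<or> x = 0 \<or> x \<in> U 0"
      by (rule cover) (use x in \<open>auto simp: sieved_def\<close>)
    moreover have "x - a \<in> power_free k \<or> x = a \<or> x \<in> U a"
      by (rule cover) (use x in \<open>auto simp: sieved_def\<close>)
    ultimately show "x \<in> pair_window k a R \<union> ({0, a} \<union> (U 0 \<union> U a))"
      using x by (auto simp: pair_window_def)
  qed
  then have "card {x\<in>sieved k a S. \<bar>real_of_int x\<bar> < R \<and> \<bar>real_of_int (x - a)\<bar> < R} \<le>
      card (pair_window k a R \<union> ({0, a} \<union> (U 0 \<union> U a)))"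
    by (intro card_mono) (auto simp: fU)
  also have "\<dots> \<le> card (pair_window k a R) + (card {0, a} + (card (U 0) + card (U a)))"
    by (intro order_trans[OF card_Un_le] add_mono order_refl)
  also have "\<dots> \<le> card (pair_window k a R) + (2 + (card (U 0) + card (U a)))"
    by (auto simp: card_insert_if)
  finally have "real (card {x\<in>sieved k a S. \<bar>real_of_int x\<bar> < R \<and> \<bar>real_of_int (x - a)\<bar> < R}) \<le>
      card (pair_window k a R) + (2 + (card (U 0) + card (U a)))"
    by (simp only: of_nat_le_iff)
  moreover have "real (card (U b)) \<le> 2 * R / real P ^ (k - 1)" for b
    unfolding U_def by (rule card_large_power_divisors[OF assms(1-3)])
  from this[of 0] this[of a] have "real (card (U 0) + card (U a)) \<le> 4 * R / real P ^ (k - 1)"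
    by simp
  ultimately show ?thesis by simp
qed

lemma card_pair_window_le_sieved:
  assumes "k > 0" "\<And>p. p \<in> S \<Longrightarrow> prime p"
  shows "card (pair_window k a R) \<le>
    card {x\<in>sieved k a S. \<bar>real_of_int x\<bar> < R \<and> \<bar>real_of_int (x - a)\<bar> < R}"
proof (rule card_mono)
  show "finite {x\<in>sieved k a S. \<bar>real_of_int x\<bar> < R \<and> \<bar>real_of_int (x - a)\<bar> < R}"
    by (rule finite_subset[OF _ finite_bounded_int[of R]]) auto
  show "pair_window k a R \<subseteq> {x\<in>sieved k a S. \<bar>real_of_int x\<bar> < R \<and> \<bar>real_of_int (x - a)\<bar> < R}"
    using assms power_free_iff_prime[OF assms(1)] by (auto simp: pair_window_def sieved_def)
qed

text \<open>The first error term depends badly on \<open>P\<close> through the period but vanishes with growing \<open>R\<close>; the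
  second is independent of \<open>R\<close>.\<close>
lemma pair_frequency_sieve_error:
  assumes "k \<ge> 2" "P \<ge> 1" "R > 0" "2 * R \<ge> \<bar>real_of_int a\<bar>"
  defines "S \<equiv> {p. prime p \<and> p \<le> P}"
  shows "\<bar>card (pair_window k a R) / (2 * R) - sieve_density k a S\<bar> \<le>
    ((\<Prod>p\<in>S. int p ^ k) + \<bar>real_of_int a\<bar> + 2) / (2 * R) + 2 / real P ^ (k - 1)"
proof -
  let ?W = "card {x\<in>sieved k a S. \<bar>real_of_int x\<bar> < R \<and> \<bar>real_of_int (x - a)\<bar> < R}"
  let ?M = "real_of_int (\<Prod>p\<in>S. int p ^ k)"
  have S: "finite S" "\<And>p. p \<in> S \<Longrightarrow> prime p" by (auto simp: S_def)
  have "real (card (pair_window k a R)) \<le> ?W"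
    using card_pair_window_le_sieved[of k S a R] assms(1) S(2) by simp
  moreover have "?W \<le> card (pair_window k a R) + 2 + 4 * R / real P ^ (k - 1)"
    unfolding S_def by (rule card_sieved_le_pair_window[OF assms(1-3)])
  moreover have "\<bar>?W - 2 * R * sieve_density k a S\<bar> \<le> ?M + \<bar>real_of_int a\<bar>"
    by (rule card_sieved_window[OF assms(1) S(1) _ assms(4)]) (rule S(2))
  ultimately have "\<bar>card (pair_window k a R) - 2 * R * sieve_density k a S\<bar> \<le>
      (?M + \<bar>real_of_int a\<bar> + 2) + 4 * R / real P ^ (k - 1)"
    by linarith
  then have "\<bar>card (pair_window k a R) - 2 * R * sieve_density k a S\<bar> / (2 * R) \<le>
      ((?M + \<bar>real_of_int a\<bar> + 2) + 4 * R / real P ^ (k - 1)) / (2 * R)"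
    using assms(3) by (intro divide_right_mono) auto
  moreover have "\<bar>card (pair_window k a R) - 2 * R * sieve_density k a S\<bar> / (2 * R) =
      \<bar>card (pair_window k a R) / (2 * R) - sieve_density k a S\<bar>"
  proof -
    have "card (pair_window k a R) / (2 * R) - sieve_density k a S =
      (card (pair_window k a R) - 2 * R * sieve_density k a S) / (2 * R)"
      using assms(3) by (simp add: field_simps)
    then show ?thesis using assms(3) by (simp add: abs_divide)
  qed
  moreover have "((?M + \<bar>real_of_int a\<bar> + 2) + 4 * R / real P ^ (k - 1)) / (2 * R) =
      (?M + \<bar>real_of_int a\<bar> + 2) / (2 * R) + 2 / real P ^ (k - 1)"
    using assms(3) by (simp add: add_divide_distrib)
  ultimately show ?thesis by simp
qed

text \<open>The tail $2 P^{1-k}$ is uniform in \<open>R\<close>, so \<open>P\<close> can be chosen first; for this fixed \<open>P\<close> the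
  contribution of the period vanishes as \<open>R\<close> grows.\<close>
lemma pair_frequency_tendsto_limit_of_densities:
  assumes k: "k \<ge> 2"
    and lim: "(\<lambda>P. sieve_density k a {p. prime p \<and> p \<le> P}) \<longlonglongrightarrow> W"
  shows "((\<lambda>R. card (pair_window k a R) / (2 * R)) \<longlongrightarrow> W) at_top"
proof (rule tendstoI)
  fix e :: real assume e: "e > 0"
  have "(\<lambda>P. 2 / real P ^ (k - 1)) \<longlonglongrightarrow> 0"
    using k by (intro real_tendsto_divide_at_top[OF tendsto_const] filterlim_pow_at_top
      filterlim_real_sequentially) auto
  then have "\<forall>\<^sub>F P in sequentially. 2 / real P ^ (k - 1) < e / 3"
    using e by (intro order_tendstoD) auto
  moreover have "\<forall>\<^sub>F P in sequentially. dist (sieve_density k a {p. prime p \<and> p \<le> P}) W < e / 3"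
    using lim e by (intro tendstoD) auto
  ultimately have "\<forall>\<^sub>F P in sequentially. 2 / real P ^ (k - 1) < e / 3 \<and>
      dist (sieve_density k a {p. prime p \<and> p \<le> P}) W < e / 3 \<and> P \<ge> 1"
    by (intro eventually_conj eventually_ge_at_top)
  then obtain P where P: "2 / real P ^ (k - 1) < e / 3" "P \<ge> 1"
      "dist (sieve_density k a {p. prime p \<and> p \<le> P}) W < e / 3"
    using eventually_happens'[OF sequentially_bot] by blast
  define S where "S = {p. prime p \<and> p \<le> P}"
  define B where "B = real_of_int (\<Prod>p\<in>S. int p ^ k) + \<bar>real_of_int a\<bar> + 2"
  have "((\<lambda>R::real. B / (2 * R)) \<longlongrightarrow> 0) at_top"
    by real_asymp
  then have "\<forall>\<^sub>F R in at_top. B / (2 * R) < e / 3"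
    using e by (intro order_tendstoD) auto
  moreover have "\<forall>\<^sub>F R::real in at_top. R > 0" "\<forall>\<^sub>F R::real in at_top. R \<ge> \<bar>real_of_int a\<bar>"
    by (auto intro: eventually_gt_at_top eventually_ge_at_top)
  ultimately show "\<forall>\<^sub>F R in at_top. dist (card (pair_window k a R) / (2 * R)) W < e"
  proof eventually_elim
    case (elim R)
    have "\<bar>card (pair_window k a R) / (2 * R) - sieve_density k a S\<bar> \<le> B / (2 * R) + 2 / real P ^ (k - 1)"
      unfolding S_def B_def by (rule pair_frequency_sieve_error) (use k P elim in auto)
    then show ?case using P elim unfolding S_def dist_real_def by linarith
  qed
qed

text \<open>The two Euler products converge absolutely, and multiplying them factor by factor gives
  the local densities: with $q = p^k$ the correction factor at $q \mid a$ turns $1 - 2/q$ into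
  $(1 - 2/q)(1 + 1/(q-2)) = 1 - 1/q$.\<close>
lemma sieve_density_tendsto_weight:
  assumes k: "k \<ge> 2"
  shows "(\<lambda>P. complex_of_real (sieve_density k a {p. prime p \<and> p \<le> P})) \<longlonglongrightarrow> weight k a"
proof -
  define f where "f = (\<lambda>n::nat. if prime n then 1 - 2 / of_nat n powr (of_nat k::complex) else 1)"
  define g where "g = (\<lambda>p::nat. if prime p \<and> int p ^ k dvd a then 1 + 1 / (of_nat p ^ k - 2) else (1::complex))"
  have pk: "real p ^ k \<ge> 4" if "prime p" for p
    using prime_power_ge_4[OF that k] by (metis of_nat_le_iff of_nat_numeral of_nat_power)
  have f: "f n = 1 - 2 / of_nat n ^ k" if "prime n" for n
    using that by (simp add: f_def powr_nat' prime_gt_0_nat)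
  have sq: "real n ^ k \<ge> real n ^ 2" if "n \<ge> 1" for n
    using that k by (intro power_increasing) auto
  have summ: "summable (\<lambda>n. 2 / real n ^ 2)"
    using summable_mult[OF inverse_power_summable[of 2, where 'a = real], of 2] by (simp add: field_simps)
  have fb: "norm (f n - 1) \<le> 2 / real n ^ 2" for n
  proof (cases "prime n")
    case True
    then have "norm (f n - 1) = 2 / real n ^ k"
      by (simp add: f norm_divide norm_power)
    also have "\<dots> \<le> 2 / real n ^ 2"
      using sq[of n] prime_gt_0_nat[OF True] by (intro divide_left_mono) auto
    finally show ?thesis .
  qed (simp add: f_def)
  have norm_g: "norm (of_nat n ^ k - 2 :: complex) = real n ^ k - 2" if "prime n" for n
  proof -
    have "(of_nat n ^ k - 2 :: complex) = of_real (real n ^ k - 2)" by simp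
    then show ?thesis using pk[OF that] by (simp only: norm_of_real)
  qed
  have gb: "norm (g n - 1) \<le> 2 / real n ^ 2" for n
  proof (cases "prime n \<and> int n ^ k dvd a")
    case True
    then have n: "prime n" by simp
    from True have "norm (g n - 1) = 1 / (real n ^ k - 2)"
      using norm_g[OF n] by (simp add: g_def norm_divide)
    also have "\<dots> \<le> 2 / real n ^ k"
    proof -
      have "1 / (y - 2) \<le> 2 / y" if "y \<ge> 4" for y :: real
        using that by (simp add: divide_simps)
      then show ?thesis using pk[OF n] .
    qed
    also have "\<dots> \<le> 2 / real n ^ 2"
      using sq[of n] prime_gt_0_nat[OF n] by (intro divide_left_mono) auto
    finally show ?thesis .
  qed (auto simp: g_def)
  have f0: "f n \<noteq> 0" for n
  proof (cases "prime n")
    case True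
    have "(of_nat n ^ k :: complex) \<noteq> 2"
      using norm_g[OF True] pk[OF True] by auto
    then show ?thesis using True by (simp add: f prime_gt_0_nat)
  qed (simp add: f_def)
  have g0: "g n \<noteq> 0" for n
  proof (cases "prime n \<and> int n ^ k dvd a")
    case True
    then have n: "prime n" by simp
    have "(of_nat n ^ k :: complex) \<noteq> 2" 
      using norm_g[OF n] pk[OF n] by auto
    moreover have "(of_nat n ^ k :: complex) \<noteq> 1"
      using norm_g[OF n] pk[OF n] by auto
    ultimately show ?thesis using True by (simp add: g_def field_simps)
  qed (auto simp: g_def)
  have conv: "convergent_prod h" if "\<And>n. norm (h n - 1) \<le> 2 / real n ^ 2" "\<And>n. h n \<noteq> 0"
    for h :: "nat \<Rightarrow> complex"
  proof -
    have "summable (\<lambda>n. norm (h n - 1))"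
      by (rule summable_comparison_test'[OF summ, of 0]) (use that in auto)
    then have "convergent_prod (\<lambda>n. 1 + (h n - 1))"
      by (rule summable_imp_convergent_prod_complex) (use that(2) in \<open>simp add: diff_eq_eq\<close>)
    then show ?thesis by simp
  qed
  have "(\<lambda>P. \<Prod>n\<le>P. f n) \<longlonglongrightarrow> prodinf f" "(\<lambda>P. \<Prod>n\<le>P. g n) \<longlonglongrightarrow> prodinf g"
    using conv fb gb f0 g0 by (auto intro!: convergent_prod_LIMSEQ)
  then have "(\<lambda>P. (\<Prod>n\<le>P. f n) * (\<Prod>n\<le>P. g n)) \<longlonglongrightarrow> prodinf f * prodinf g"
    by (rule tendsto_mult)
  moreover have "prodinf f * prodinf g = weight k a"
    by (simp add: weight_def xi_def f_def g_def)
  moreover have "(\<Prod>n\<le>P. f n) * (\<Prod>n\<le>P. g n) =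
      complex_of_real (sieve_density k a {p. prime p \<and> p \<le> P})" for P
  proof -
    have fg: "f n * g n = complex_of_real (1 - excluded_residues k a n / real n ^ k)" if n: "prime n" for n
    proof -
      have "(of_nat n ^ k :: complex) \<noteq> 2" "of_nat n \<noteq> (0::complex)"
        using norm_g[OF n] pk[OF n] prime_gt_0_nat[OF n] by auto
      then show ?thesis
        using n by (simp add: f g_def excluded_residues_def divide_simps)
    qed
    have "(\<Prod>n\<le>P. f n) * (\<Prod>n\<le>P. g n) = (\<Prod>n\<le>P. f n * g n)"
      by (simp add: prod.distrib)
    also have "\<dots> = (\<Prod>n\<in>{p. prime p \<and> p \<le> P}. f n * g n)"
      by (rule prod.mono_neutral_right) (auto simp: f_def g_def)
    also have "\<dots> = (\<Prod>n\<in>{p. prime p \<and> p \<le> P}. complex_of_real (1 - excluded_residues k a n / real n ^ k))"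
      by (rule prod.cong) (use fg in auto)
    finally show ?thesis by (simp add: sieve_density_def)
  qed
  ultimately show ?thesis by simp
qed

lemma weight_eq_of_real:
  assumes "k \<ge> 2"
  shows "weight k a = complex_of_real (Re (weight k a))"
proof -
  have "(\<lambda>P::nat. 0) \<longlonglongrightarrow> Im (weight k a)"
    using tendsto_Im[OF sieve_density_tendsto_weight[OF assms, of a]] by simp
  then have "Im (weight k a) = 0"
    using LIMSEQ_unique tendsto_const by metis
  then show ?thesis by (simp add: complex_eq_iff)
qed

lemma pair_frequency_tendsto_weight:
  assumes "k \<ge> 2"
  shows "((\<lambda>R. card (pair_window k a R) / (2 * R)) \<longlongrightarrow> Re (weight k a)) at_top"
  using tendsto_Re[OF sieve_density_tendsto_weight[OF assms, of a]]
  by (intro pair_frequency_tendsto_limit_of_densities[OF assms]) simp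

section \<open>The pair count as a truncated double Moebius sum\<close>

text \<open>The points \<open>0\<close> and \<open>a\<close> are left out because every $d^k$ divides \<open>0\<close>: there the Moebius
  expansion is an infinite sum.\<close>
definition punctured_window :: "int \<Rightarrow> real \<Rightarrow> int set" where
  "punctured_window a R = {x. x \<noteq> 0 \<and> x \<noteq> a \<and> \<bar>real_of_int x\<bar> < R \<and> \<bar>real_of_int (x - a)\<bar> < R}"

lemma finite_punctured_window [simp]: "finite (punctured_window a R)"
  by (rule finite_subset[OF _ finite_bounded_int[of R]]) (auto simp: punctured_window_def)

text \<open>The natural density of the solutions of both divisibility conditions: if there is a
  solution at all, they form one residue class modulo the least common multiple.\<close>
definition joint_density :: "nat \<Rightarrow> int \<Rightarrow> nat \<Rightarrow> nat \<Rightarrow> real" where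
  "joint_density k a d e =
     (if \<exists>x. int d ^ k dvd x \<and> int e ^ k dvd x - a then 1 / real (lcm (d ^ k) (e ^ k)) else 0)"

text \<open>The error \<open>1\<close> of the class count grows by \<open>2\<close> for the two removed points and by at most \<open>\<bar>a\<bar>\<close>
  because the window is shorter than \<open>2 * R\<close>.\<close>
lemma card_joint_divisibility:
  assumes "d \<ge> 1" "e \<ge> 1" "2 * R \<ge> \<bar>real_of_int a\<bar>"
  shows "\<bar>real (card {x\<in>punctured_window a R. int d ^ k dvd x \<and> int e ^ k dvd x - a}) -
    2 * R * joint_density k a d e\<bar> \<le> \<bar>real_of_int a\<bar> + 3"
proof (cases "\<exists>x. int d ^ k dvd x \<and> int e ^ k dvd x - a")
  case False
  then have "{x\<in>punctured_window a R. int d ^ k dvd x \<and> int e ^ k dvd x - a} = {}" by auto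
  then have "card {x\<in>punctured_window a R. int d ^ k dvd x \<and> int e ^ k dvd x - a} = 0"
    by (simp only: card.empty)
  moreover have "joint_density k a d e = 0" using False by (simp only: joint_density_def if_False)
  ultimately show ?thesis by (simp only:)
next
  case True
  then obtain r where r: "int d ^ k dvd r" "int e ^ k dvd r - a" by blast
  define L where "L = lcm (int d ^ k) (int e ^ k)"
  have L: "L > 0" using assms by (simp add: L_def lcm_pos_int)
  have L': "joint_density k a d e = 1 / L"
  proof -
    have "int (lcm (d ^ k) (e ^ k)) = L" unfolding L_def by (simp flip: of_nat_power)
    then have "real (lcm (d ^ k) (e ^ k)) = L" by (metis of_int_of_nat_eq)
    then show ?thesis using True by (simp add: joint_density_def)
  qed
  have iff: "int d ^ k dvd x \<and> int e ^ k dvd x - a \<longleftrightarrow> L dvd x - r" for x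
  proof -
    have "int d ^ k dvd x \<longleftrightarrow> int d ^ k dvd x - r"
      using r(1) by (metis diff_add_cancel dvd_add_left_iff)
    moreover have "int e ^ k dvd x - a \<longleftrightarrow> int e ^ k dvd x - r"
    proof -
      have "x - a = (x - r) + (r - a)" by simp
      then show ?thesis using r(2) by (metis dvd_add_left_iff)
    qed
    ultimately show ?thesis by (simp add: L_def)
  qed
  let ?u = "max (-R) (a - R)" and ?v = "min R (a + R)"
  let ?C = "{x::int. ?u < x \<and> x < ?v \<and> L dvd x - r}"
  have len: "?v - ?u = 2 * R - \<bar>real_of_int a\<bar>" by (rule window_length)
  have C: "\<bar>real (card ?C) - (2 * R - \<bar>real_of_int a\<bar>) / L\<bar> \<le> 1"
    unfolding len[symmetric] using len assms(3) L by (intro card_residue_class_interval) auto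
  have eq: "{x\<in>punctured_window a R. int d ^ k dvd x \<and> int e ^ k dvd x - a} = ?C - {0, a}"
    unfolding iff punctured_window_def using window_eq[of _ R a] by auto
  have finC: "finite ?C"
  proof (rule finite_subset)
    show "?C \<subseteq> {x. ?u < real_of_int x \<and> real_of_int x < ?v}" by auto
  qed (simp only: open_interval_int_eq finite_atLeastAtMost_int)
  have "card ?C \<le> card ((?C - {0, a}) \<union> {0, a})"
    using finC by (intro card_mono) auto
  also have "\<dots> \<le> card (?C - {0, a}) + card {0, a}" by (rule card_Un_le)
  also have "card {0, a} \<le> 2" by (simp add: card_insert_if)
  finally have "card ?C \<le> card (?C - {0, a}) + 2" by simp
  moreover have "card (?C - {0, a}) \<le> card ?C"
    using finC by (intro card_mono) auto
  moreover have "0 \<le> \<bar>real_of_int a\<bar> / L" "\<bar>real_of_int a\<bar> / L \<le> \<bar>real_of_int a\<bar>"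
    using L by (auto simp: divide_le_eq mult_le_cancel_left1)
  ultimately have "\<bar>real (card (?C - {0, a})) - 2 * R / L\<bar> \<le> \<bar>real_of_int a\<bar> + 3"
    using C unfolding diff_divide_distrib by linarith
  then show ?thesis unfolding eq L' by simp
qed

lemma joint_density_nonneg: "joint_density k a d e \<ge> 0"
  by (simp add: joint_density_def)

lemma joint_density_1: "joint_density k a d (Suc 0) = 1 / real d ^ k"
proof -
  have "\<exists>x. int d ^ k dvd x \<and> int (Suc 0) ^ k dvd x - a" by auto
  then show ?thesis by (simp add: joint_density_def)
qed

text \<open>If the two congruences are compatible, the greatest common divisor of the moduli
  divides \<open>a\<close>, so the joint density exceeds the product of the densities at most by the
  factor \<open>\<bar>a\<bar>\<close>.\<close>
lemma joint_density_le:
  assumes "a \<noteq> 0" "d \<ge> 1" "e \<ge> 1"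
  shows "joint_density k a d e \<le> \<bar>real_of_int a\<bar> * (1 / real d ^ k) * (1 / real e ^ k)"
proof (cases "\<exists>x. int d ^ k dvd x \<and> int e ^ k dvd x - a")
  case True
  then obtain x where x: "int d ^ k dvd x" "int e ^ k dvd x - a" by blast
  let ?g = "gcd (d ^ k) (e ^ k)" and ?l = "lcm (d ^ k) (e ^ k)"
  have "int ?g dvd int d ^ k" "int ?g dvd int e ^ k"
    unfolding of_nat_power[symmetric] int_dvd_int_iff by (rule gcd_dvd1, rule gcd_dvd2)
  then have "int ?g dvd x" "int ?g dvd x - a"
    using x dvd_trans by blast+
  then have "int ?g dvd a" by (metis diff_diff_eq2 add_diff_cancel_left' dvd_diff)
  then have "int ?g \<le> \<bar>a\<bar>"
    using dvd_imp_le_int[OF assms(1), of "int ?g"] by simp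
  then have g: "real ?g \<le> \<bar>real_of_int a\<bar>"
    by (metis of_int_abs of_int_le_iff of_int_of_nat_eq)
  have "real ?g * real ?l = real d ^ k * real e ^ k"
    by (metis of_nat_mult of_nat_power prod_gcd_lcm_nat)
  moreover have "real ?l > 0"
    using assms by (simp add: lcm_pos_nat)
  ultimately have "1 / real ?l = real ?g * (1 / real d ^ k) * (1 / real e ^ k)"
    using assms by (simp add: field_simps)
  also have "\<dots> \<le> \<bar>real_of_int a\<bar> * (1 / real d ^ k) * (1 / real e ^ k)"
    using g by (intro mult_right_mono) auto
  finally show ?thesis using True by (simp add: joint_density_def)
next
  case False
  then have "joint_density k a d e = 0" by (simp only: joint_density_def if_False)
  then show ?thesis by simp
qed

definition density_sum :: "nat \<Rightarrow> int \<Rightarrow> nat \<Rightarrow> nat \<Rightarrow> real" where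
  "density_sum k a D Y = (\<Sum>d\<in>{1..D}. \<Sum>e\<in>{1..Y}. moebius_mu d * moebius_mu e * joint_density k a d e)"

lemma abs_moebius_mu_prod_le: "\<bar>moebius_mu d * moebius_mu e * joint_density k a d e\<bar> \<le> joint_density k a d e"
proof -
  have "\<bar>moebius_mu d * moebius_mu e\<bar> \<le> 1"
    unfolding abs_mult using abs_moebius_mu_le_1 by (intro mult_le_one) auto
  then show ?thesis
    using joint_density_nonneg[of k a d e] by (simp add: abs_mult mult_left_le_one_le)
qed

lemma sum_inverse_powers_le_2:
  assumes "k \<ge> 2"
  shows "(\<Sum>d\<in>{1..D}. 1 / real d ^ k) \<le> 2"
proof (cases "D = 0")
  case False
  then have "{1..D} = insert 1 {1<..D}" by auto
  then have "(\<Sum>d\<in>{1..D}. 1 / real d ^ k) = 1 + (\<Sum>d\<in>{1<..D}. 1 / real d ^ k)" by simp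
  with sum_inverse_powers_tail[OF assms, of 1 D] show ?thesis by simp
qed simp

lemma density_sum_block_le:
  assumes "a \<noteq> 0" "\<And>d. d \<in> A \<Longrightarrow> d \<ge> 1" "\<And>e. e \<in> B \<Longrightarrow> e \<ge> 1"
    "(\<Sum>d\<in>A. 1 / real d ^ k) \<le> \<alpha>" "(\<Sum>e\<in>B. 1 / real e ^ k) \<le> \<beta>"
  shows "\<bar>\<Sum>d\<in>A. \<Sum>e\<in>B. moebius_mu d * moebius_mu e * joint_density k a d e\<bar> \<le> \<bar>real_of_int a\<bar> * \<alpha> * \<beta>"
proof -
  have "\<bar>\<Sum>d\<in>A. \<Sum>e\<in>B. moebius_mu d * moebius_mu e * joint_density k a d e\<bar> \<le>
      (\<Sum>d\<in>A. \<Sum>e\<in>B. \<bar>moebius_mu d * moebius_mu e * joint_density k a d e\<bar>)"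
    by (intro order_trans[OF sum_abs] sum_mono sum_abs)
  also have "\<dots> \<le> (\<Sum>d\<in>A. \<Sum>e\<in>B. \<bar>real_of_int a\<bar> * (1 / real d ^ k) * (1 / real e ^ k))"
    by (intro sum_mono order_trans[OF abs_moebius_mu_prod_le] joint_density_le assms(1-3))
  also have "\<dots> = \<bar>real_of_int a\<bar> * (\<Sum>d\<in>A. 1 / real d ^ k) * (\<Sum>e\<in>B. 1 / real e ^ k)"
    by (simp add: sum_distrib_left sum_distrib_right mult_ac)
  also have "\<dots> \<le> \<bar>real_of_int a\<bar> * \<alpha> * \<beta>"
  proof -
    have "0 \<le> (\<Sum>d\<in>A. 1 / real d ^ k)" "0 \<le> (\<Sum>e\<in>B. 1 / real e ^ k)" by (auto intro!: sum_nonneg)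
    then show ?thesis using assms(4,5) by (intro mult_mono mult_left_mono) auto
  qed
  finally show ?thesis .
qed

text \<open>The terms of the larger sum that are missing in the smaller one have \<open>e > Y\<close> or \<open>d > D\<close>; over
  either range one of the two factors of the bound from \<open>joint_density_le\<close> sums to a tail.\<close>
lemma density_sum_cauchy:
  assumes "k \<ge> 2" "a \<noteq> 0" "1 \<le> D" "D \<le> D'" "1 \<le> Y" "Y \<le> Y'"
  shows "\<bar>density_sum k a D' Y' - density_sum k a D Y\<bar> \<le>
    2 * \<bar>real_of_int a\<bar> * (1 / real D ^ (k - 1) + 1 / real Y ^ (k - 1))"
proof -
  let ?t = "\<lambda>d e. moebius_mu d * moebius_mu e * joint_density k a d e"
  have D: "{1..D'} = {1..D} \<union> {D<..D'}" and Y: "{1..Y'} = {1..Y} \<union> {Y<..Y'}"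
    using assms by auto
  have "density_sum k a D' Y' = (\<Sum>d\<in>{1..D}. \<Sum>e\<in>{1..Y'}. ?t d e) + (\<Sum>d\<in>{D<..D'}. \<Sum>e\<in>{1..Y'}. ?t d e)"
    unfolding density_sum_def D by (rule sum.union_disjoint) auto
  also have "(\<Sum>d\<in>{1..D}. \<Sum>e\<in>{1..Y'}. ?t d e) =
      (\<Sum>d\<in>{1..D}. (\<Sum>e\<in>{1..Y}. ?t d e) + (\<Sum>e\<in>{Y<..Y'}. ?t d e))"
    unfolding Y by (intro sum.cong refl sum.union_disjoint) auto
  finally have "density_sum k a D' Y' - density_sum k a D Y =
      (\<Sum>d\<in>{1..D}. \<Sum>e\<in>{Y<..Y'}. ?t d e) + (\<Sum>d\<in>{D<..D'}. \<Sum>e\<in>{1..Y'}. ?t d e)"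
    by (simp add: density_sum_def sum.distrib)
  moreover have "\<bar>\<Sum>d\<in>{1..D}. \<Sum>e\<in>{Y<..Y'}. ?t d e\<bar> \<le> \<bar>real_of_int a\<bar> * 2 * (1 / real Y ^ (k - 1))"
    using assms by (intro density_sum_block_le sum_inverse_powers_le_2 sum_inverse_powers_tail) auto
  moreover have "\<bar>\<Sum>d\<in>{D<..D'}. \<Sum>e\<in>{1..Y'}. ?t d e\<bar> \<le> \<bar>real_of_int a\<bar> * (1 / real D ^ (k - 1)) * 2"
    using assms by (intro density_sum_block_le sum_inverse_powers_le_2 sum_inverse_powers_tail) auto
  ultimately show ?thesis
    by (simp add: algebra_simps) linarith
qed

text \<open>With the second variable restricted to \<open>e = 1\<close> the joint density is $1/d^k$ whatever \<open>a\<close> is; this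
  covers \<open>a = 0\<close>, for which \<open>joint_density_le\<close> fails.\<close>
lemma density_sum_cauchy_0:
  assumes "k \<ge> 2" "1 \<le> D" "D \<le> D'"
  shows "\<bar>density_sum k a D' 1 - density_sum k a D 1\<bar> \<le> 1 / real D ^ (k - 1)"
proof -
  have D: "{1..D'} = {1..D} \<union> {D<..D'}" using assms by auto
  have G: "density_sum k a D 1 = (\<Sum>d\<in>{1..D}. moebius_mu d * (1 / real d ^ k))" for D
    by (simp add: density_sum_def joint_density_1)
  have "density_sum k a D' 1 - density_sum k a D 1 = (\<Sum>d\<in>{D<..D'}. moebius_mu d * (1 / real d ^ k))"
    unfolding G D by (subst sum.union_disjoint) auto
  also have "\<bar>\<dots>\<bar> \<le> (\<Sum>d\<in>{D<..D'}. \<bar>moebius_mu d * (1 / real d ^ k)\<bar>)" by (rule sum_abs)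
  also have "\<dots> \<le> (\<Sum>d\<in>{D<..D'}. 1 / real d ^ k)"
    using abs_moebius_mu_le_1 by (intro sum_mono) (simp add: abs_mult divide_right_mono)
  also have "\<dots> \<le> 1 / real D ^ (k - 1)"
    using assms by (intro sum_inverse_powers_tail) auto
  finally show ?thesis .
qed

definition moebius_sum :: "nat \<Rightarrow> nat set \<Rightarrow> int \<Rightarrow> real" where
  "moebius_sum k E x = (\<Sum>e\<in>E. moebius_mu e * of_bool (int e ^ k dvd x))"

text \<open>Under the bound \<open>\<bar>x\<bar> < R \<le> D ^ k\<close> all \<open>d\<close> with $d^k \mid x$ lie below \<open>D\<close>, so the
  expansion is complete.\<close>
lemma moebius_sum_eq_indicator:
  assumes "k > 0" "x \<noteq> 0" "\<bar>real_of_int x\<bar> < R" "R \<le> real D ^ k" "finite E" "{1..D} \<subseteq> E"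
  shows "moebius_sum k E x = of_bool (x \<in> power_free k)"
proof -
  have "{d. int d ^ k dvd x} \<subseteq> {1..D}"
  proof
    fix d assume "d \<in> {d. int d ^ k dvd x}"
    then have d: "int d ^ k dvd x" by simp
    have "d \<noteq> 0" using d assms by (auto simp: power_0_left)
    moreover have "real d ^ k < real D ^ k"
      using kth_power_divisor_bound[OF assms(2,1,3) d] assms(4) by simp
    then have "d < D" by (meson of_nat_0_le_iff of_nat_less_iff power_less_imp_less_base)
    ultimately show "d \<in> {1..D}" by simp
  qed
  then have "moebius_sum k E x = (\<Sum>d | int d ^ k dvd x. moebius_mu d)"
    unfolding moebius_sum_def using assms(5,6)
    by (intro sum.mono_neutral_cong_right) auto
  with sum_moebius_kth_power_divisors[OF assms(2,1)] show ?thesis by simp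
qed

lemma sum_of_bool_eq_card:
  assumes "finite A"
  shows "(\<Sum>x\<in>A. of_bool (P x)) = real (card {x\<in>A. P x})"
  using assms by (simp add: of_bool_def sum.If_cases Int_def)

text \<open>After exchanging the sums, each pair \<open>(d, e)\<close> counts one residue class and costs an error of
  at most \<open>\<bar>a\<bar> + 3\<close>.\<close>
lemma sum_moebius_sums_error:
  assumes "2 * R \<ge> \<bar>real_of_int a\<bar>"
  shows "\<bar>(\<Sum>x\<in>punctured_window a R. moebius_sum k {1..D} x * moebius_sum k {1..Y} (x - a)) -
    2 * R * density_sum k a D Y\<bar> \<le> (\<bar>real_of_int a\<bar> + 3) * real (D * Y)"
proof -
  let ?c = "\<lambda>d e. real (card {x\<in>punctured_window a R. int d ^ k dvd x \<and> int e ^ k dvd x - a})"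
  have "(\<Sum>x\<in>punctured_window a R. moebius_sum k {1..D} x * moebius_sum k {1..Y} (x - a)) =
      (\<Sum>x\<in>punctured_window a R. \<Sum>d\<in>{1..D}. \<Sum>e\<in>{1..Y}. moebius_mu d * moebius_mu e *
        of_bool (int d ^ k dvd x \<and> int e ^ k dvd x - a))"
    unfolding moebius_sum_def sum_product by (intro sum.cong refl) (auto simp: of_bool_conj)
  also have "\<dots> = (\<Sum>d\<in>{1..D}. \<Sum>e\<in>{1..Y}. \<Sum>x\<in>punctured_window a R. moebius_mu d * moebius_mu e *
        of_bool (int d ^ k dvd x \<and> int e ^ k dvd x - a))"
    by (subst sum.swap) (intro sum.cong refl sum.swap)
  also have "\<dots> = (\<Sum>d\<in>{1..D}. \<Sum>e\<in>{1..Y}. moebius_mu d * moebius_mu e * ?c d e)"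
    by (simp only: sum_distrib_left[symmetric] sum_of_bool_eq_card[OF finite_punctured_window])
  finally have eq: "(\<Sum>x\<in>punctured_window a R. moebius_sum k {1..D} x * moebius_sum k {1..Y} (x - a)) =
      (\<Sum>d\<in>{1..D}. \<Sum>e\<in>{1..Y}. moebius_mu d * moebius_mu e * ?c d e)" .
  have diff: "(\<Sum>x\<in>punctured_window a R. moebius_sum k {1..D} x * moebius_sum k {1..Y} (x - a)) -
      2 * R * density_sum k a D Y =
      (\<Sum>d\<in>{1..D}. \<Sum>e\<in>{1..Y}. moebius_mu d * moebius_mu e * (?c d e - 2 * R * joint_density k a d e))"
    unfolding eq density_sum_def sum_distrib_left sum_subtractf[symmetric]
    by (intro sum.cong refl) (simp only: right_diff_distrib mult_ac)
  have "\<bar>(\<Sum>x\<in>punctured_window a R. moebius_sum k {1..D} x * moebius_sum k {1..Y} (x - a)) -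
      2 * R * density_sum k a D Y\<bar> \<le>
      (\<Sum>d\<in>{1..D}. \<Sum>e\<in>{1..Y}. \<bar>moebius_mu d * moebius_mu e * (?c d e - 2 * R * joint_density k a d e)\<bar>)"
    unfolding diff by (intro order_trans[OF sum_abs] sum_mono sum_abs)
  also have "\<dots> \<le> (\<Sum>d\<in>{1..D}. \<Sum>e\<in>{1..Y}. \<bar>real_of_int a\<bar> + 3)"
  proof (intro sum_mono)
    fix d e assume de: "d \<in> {1..D}" "e \<in> {1..Y}"
    have "\<bar>moebius_mu d * moebius_mu e\<bar> \<le> 1"
      unfolding abs_mult using abs_moebius_mu_le_1 by (intro mult_le_one) auto
    moreover have "\<bar>?c d e - 2 * R * joint_density k a d e\<bar> \<le> \<bar>real_of_int a\<bar> + 3"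
      using de assms by (intro card_joint_divisibility) auto
    ultimately have "\<bar>moebius_mu d * moebius_mu e\<bar> * \<bar>?c d e - 2 * R * joint_density k a d e\<bar> \<le>
        1 * (\<bar>real_of_int a\<bar> + 3)"
      by (intro mult_mono) auto
    then show "\<bar>moebius_mu d * moebius_mu e * (?c d e - 2 * R * joint_density k a d e)\<bar> \<le> \<bar>real_of_int a\<bar> + 3"
      by (simp only: abs_mult mult_1)
  qed
  also have "\<dots> = (\<bar>real_of_int a\<bar> + 3) * real (D * Y)" by simp
  finally show ?thesis .
qed

lemma zero_not_power_free: "k > 0 \<Longrightarrow> 0 \<notin> power_free k"
  by (auto simp: power_free_def intro: exI[of _ 2])

lemma card_pair_window_eq_sum:
  assumes "k > 0" "R \<le> real D ^ k"
  shows "real (card (pair_window k a R)) =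
    (\<Sum>x\<in>punctured_window a R. moebius_sum k {1..D} x * of_bool (x - a \<in> power_free k))"
proof -
  have "pair_window k a R = {x\<in>punctured_window a R. x \<in> power_free k \<and> x - a \<in> power_free k}"
    using zero_not_power_free[OF assms(1)] by (auto simp: pair_window_def punctured_window_def)
  then have "real (card (pair_window k a R)) =
      (\<Sum>x\<in>punctured_window a R. of_bool (x \<in> power_free k \<and> x - a \<in> power_free k))"
    by (simp only: sum_of_bool_eq_card[OF finite_punctured_window])
  also have "\<dots> = (\<Sum>x\<in>punctured_window a R. moebius_sum k {1..D} x * of_bool (x - a \<in> power_free k))"
    using moebius_sum_eq_indicator[OF assms(1) _ _ assms(2)]
    by (intro sum.cong refl) (auto simp: punctured_window_def of_bool_conj)
  finally show ?thesis .
qed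

text \<open>For \<open>a = 0\<close> the second indicator equals the first one and can be replaced by \<open>1\<close>, which is the
  Moebius sum over \<open>e = 1\<close> alone.\<close>
lemma pair_count_error_0:
  assumes "k > 0" "R \<ge> 0" "R \<le> real D ^ k"
  shows "\<bar>card (pair_window k 0 R) - 2 * R * density_sum k 0 D 1\<bar> \<le> 3 * real D"
proof -
  have "real (card (pair_window k 0 R)) =
      (\<Sum>x\<in>punctured_window 0 R. moebius_sum k {1..D} x * of_bool (x - 0 \<in> power_free k))"
    by (rule card_pair_window_eq_sum) (use assms in auto)
  also have "\<dots> = (\<Sum>x\<in>punctured_window 0 R. moebius_sum k {1..D} x * moebius_sum k {1..1} (x - 0))"
  proof (rule sum.cong)
    fix x assume "x \<in> punctured_window 0 R"
    then have "moebius_sum k {1..D} x = of_bool (x \<in> power_free k)"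
      by (intro moebius_sum_eq_indicator[OF assms(1) _ _ assms(3)]) (auto simp: punctured_window_def)
    then show "moebius_sum k {1..D} x * of_bool (x - 0 \<in> power_free k) =
        moebius_sum k {1..D} x * moebius_sum k {1..1} (x - 0)"
      by (simp add: moebius_sum_def[of k "{1..1}"] moebius_sum_def[of k "{Suc 0}"])
  qed simp
  finally show ?thesis
    using sum_moebius_sums_error[of 0 R k D 1] assms by simp
qed

text \<open>Only the divisors \<open>e\<close> of the shifted variable are truncated: for \<open>e > Y\<close> the indicator of
  the first variable is bounded by \<open>1\<close>, so no divisor count enters the tail.\<close>
lemma pair_count_error:
  assumes "k \<ge> 2" "R > 0" "2 * R \<ge> \<bar>real_of_int a\<bar>" "R \<le> real D ^ k" "Y \<ge> 1"
  shows "\<bar>card (pair_window k a R) - 2 * R * density_sum k a D Y\<bar> \<le>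
    2 * R / real Y ^ (k - 1) + (\<bar>real_of_int a\<bar> + 3) * real (D * Y)"
proof -
  let ?f = "moebius_sum k {1..D}"
  let ?I = "punctured_window a R"
  have k: "k > 0" using assms by simp
  have split: "of_bool (x - a \<in> power_free k) = moebius_sum k {1..Y} (x - a) + moebius_sum k {Y<..D} (x - a)"
    if "x \<in> ?I" for x
  proof -
    have "of_bool (x - a \<in> power_free k) = moebius_sum k ({1..Y} \<union> {Y<..D}) (x - a)"
      by (rule moebius_sum_eq_indicator[OF k _ _ assms(4), symmetric])
        (use that in \<open>auto simp: punctured_window_def\<close>)
    also have "\<dots> = moebius_sum k {1..Y} (x - a) + moebius_sum k {Y<..D} (x - a)"
      unfolding moebius_sum_def by (rule sum.union_disjoint) auto
    finally show ?thesis .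
  qed
  have "real (card (pair_window k a R)) =
      (\<Sum>x\<in>?I. ?f x * moebius_sum k {1..Y} (x - a) + ?f x * moebius_sum k {Y<..D} (x - a))"
    unfolding card_pair_window_eq_sum[OF k assms(4)]
    by (intro sum.cong refl) (simp only: split distrib_left)
  then have "real (card (pair_window k a R)) - 2 * R * density_sum k a D Y =
      ((\<Sum>x\<in>?I. ?f x * moebius_sum k {1..Y} (x - a)) - 2 * R * density_sum k a D Y) +
      (\<Sum>x\<in>?I. ?f x * moebius_sum k {Y<..D} (x - a))"
    by (simp add: sum.distrib)
  moreover have "\<bar>\<Sum>x\<in>?I. ?f x * moebius_sum k {Y<..D} (x - a)\<bar> \<le> 2 * R / real Y ^ (k - 1)"
  proof -
    have "\<bar>\<Sum>x\<in>?I. ?f x * moebius_sum k {Y<..D} (x - a)\<bar> \<le> (\<Sum>x\<in>?I. \<bar>?f x * moebius_sum k {Y<..D} (x - a)\<bar>)"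
      by (rule sum_abs)
    also have "\<dots> \<le> (\<Sum>x\<in>?I. \<Sum>e\<in>{Y<..D}. of_bool (int e ^ k dvd x - a))"
    proof (rule sum_mono)
      fix x assume x: "x \<in> ?I"
      then have "?f x = of_bool (x \<in> power_free k)"
        by (intro moebius_sum_eq_indicator[OF k _ _ assms(4)]) (auto simp: punctured_window_def)
      then have "\<bar>?f x\<bar> \<le> 1" by simp
      then have "\<bar>?f x * moebius_sum k {Y<..D} (x - a)\<bar> \<le> \<bar>moebius_sum k {Y<..D} (x - a)\<bar>"
        by (simp add: abs_mult mult_left_le_one_le)
      also have "\<dots> \<le> (\<Sum>e\<in>{Y<..D}. \<bar>moebius_mu e * of_bool (int e ^ k dvd x - a)\<bar>)"
        unfolding moebius_sum_def by (rule sum_abs)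
      also have "\<dots> \<le> (\<Sum>e\<in>{Y<..D}. of_bool (int e ^ k dvd x - a))"
        using abs_moebius_mu_le_1 by (intro sum_mono) (auto simp: abs_mult)
      finally show "\<bar>?f x * moebius_sum k {Y<..D} (x - a)\<bar> \<le> (\<Sum>e\<in>{Y<..D}. of_bool (int e ^ k dvd x - a))" .
    qed
    also have "\<dots> = (\<Sum>e\<in>{Y<..D}. real (card {x\<in>?I. int e ^ k dvd x - a}))"
      by (subst sum.swap) (simp only: sum_of_bool_eq_card[OF finite_punctured_window])
    also have "\<dots> \<le> (\<Sum>e\<in>{Y<..D}. 2 * R * (1 / real e ^ k))"
    proof (rule sum_mono)
      fix e assume "e \<in> {Y<..D}"
      then have q: "int e ^ k > 0" by simp
      have "card {x\<in>?I. int e ^ k dvd x - a} \<le>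
          card {x::int. x \<noteq> a \<and> \<bar>real_of_int (x - a)\<bar> < R \<and> int e ^ k dvd x - a}"
        by (intro card_mono finite_subset[OF _ finite_shifted_window[of a R]])
          (auto simp: punctured_window_def)
      then have "real (card {x\<in>?I. int e ^ k dvd x - a}) \<le>
          card {x::int. x \<noteq> a \<and> \<bar>real_of_int (x - a)\<bar> < R \<and> int e ^ k dvd x - a}"
        by simp
      also have "\<dots> \<le> 2 * R / int e ^ k"
        by (rule card_nonzero_multiples_shift[OF assms(2) q])
      finally show "real (card {x\<in>?I. int e ^ k dvd x - a}) \<le> 2 * R * (1 / real e ^ k)" by simp
    qed
    also have "\<dots> \<le> 2 * R * (1 / real Y ^ (k - 1))"
      unfolding sum_distrib_left[symmetric]
      using sum_inverse_powers_tail[OF assms(1,5)] assms(2) by (intro mult_left_mono) auto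
    finally show ?thesis by simp
  qed
  moreover have "\<bar>(\<Sum>x\<in>?I. ?f x * moebius_sum k {1..Y} (x - a)) - 2 * R * density_sum k a D Y\<bar> \<le>
      (\<bar>real_of_int a\<bar> + 3) * real (D * Y)"
    by (rule sum_moebius_sums_error[OF assms(3)])
  ultimately show ?thesis by linarith
qed

section \<open>The rate of convergence\<close>

text \<open>Since \<open>f - G\<close> tends to \<open>0\<close>, \<open>G\<close> has the limit \<open>W\<close> as well; letting
  \<open>R'\<close> tend to infinity in the Cauchy estimate bounds its distance to \<open>W\<close>.\<close>
lemma rate_from_cauchy_approximation:
  fixes f G :: "real \<Rightarrow> real"
  assumes lim: "(f \<longlongrightarrow> W) at_top" and "\<eta> > 0"
    and approx: "\<And>R. R \<ge> R0 \<Longrightarrow> \<bar>f R - G R\<bar> \<le> C1 * R powr - \<eta>"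
    and cauchy: "\<And>R R'. R0 \<le> R \<Longrightarrow> R \<le> R' \<Longrightarrow> \<bar>G R' - G R\<bar> \<le> C2 * R powr - \<eta>"
    and R: "R \<ge> R0"
  shows "\<bar>W - f R\<bar> \<le> (C1 + C2) * R powr - \<eta>"
proof -
  have "((\<lambda>R. C1 * R powr - \<eta>) \<longlongrightarrow> C1 * 0) at_top"
    using assms(2) by (intro tendsto_mult_left tendsto_neg_powr filterlim_ident) simp
  then have "((\<lambda>R. C1 * R powr - \<eta>) \<longlongrightarrow> 0) at_top" by simp
  moreover have "\<forall>\<^sub>F R in at_top. norm (f R - G R) \<le> C1 * R powr - \<eta>"
    by (rule eventually_mono[OF eventually_ge_at_top[of R0]]) (use approx in auto)
  ultimately have "((\<lambda>R. f R - G R) \<longlongrightarrow> 0) at_top"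
    by (rule Lim_null_comparison[rotated])
  from tendsto_diff[OF lim this] have "(G \<longlongrightarrow> W) at_top" by simp
  then have "((\<lambda>R'. \<bar>G R' - G R\<bar>) \<longlongrightarrow> \<bar>W - G R\<bar>) at_top"
    by (intro tendsto_intros)
  then have "\<bar>W - G R\<bar> \<le> C2 * R powr - \<eta>"
    by (rule tendsto_upperbound)
      (auto intro!: eventually_mono[OF eventually_ge_at_top[of R]] cauchy R)
  moreover have "\<bar>f R - G R\<bar> \<le> C1 * R powr - \<eta>" by (rule approx[OF R])
  ultimately show ?thesis unfolding distrib_right by linarith
qed

text \<open>Rounding up guarantees \<open>R \<le> cutoff (1 / k) R ^ k\<close>, so that no divisor is missed, and loses at
  most a factor \<open>2\<close> for \<open>R \<ge> 1\<close>.\<close>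
definition cutoff :: "real \<Rightarrow> real \<Rightarrow> nat" where
  "cutoff \<theta> R = nat \<lceil>R powr \<theta>\<rceil>"

lemma cutoff_bounds:
  assumes "R \<ge> 1" "\<theta> \<ge> 0"
  shows "R powr \<theta> \<le> cutoff \<theta> R" "cutoff \<theta> R \<le> 2 * R powr \<theta>" "1 \<le> cutoff \<theta> R"
proof -
  have "1 \<le> R powr \<theta>" using assms by (rule ge_one_powr_ge_zero)
  then show "R powr \<theta> \<le> cutoff \<theta> R" "cutoff \<theta> R \<le> 2 * R powr \<theta>" "1 \<le> cutoff \<theta> R"
    unfolding cutoff_def by linarith+
qed

lemma cutoff_mono:
  assumes "0 \<le> R" "R \<le> R'" "\<theta> \<ge> 0"
  shows "cutoff \<theta> R \<le> cutoff \<theta> R'"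
  unfolding cutoff_def using assms by (intro nat_mono ceiling_mono powr_mono2)

lemma powr_le_cutoff_power:
  assumes "R \<ge> 1" "\<theta> \<ge> 0"
  shows "R powr (\<theta> * n) \<le> real (cutoff \<theta> R) ^ n"
proof -
  have "R powr (\<theta> * n) = (R powr \<theta>) ^ n"
    using assms by (simp add: powr_powr[symmetric] powr_realpow)
  also have "\<dots> \<le> real (cutoff \<theta> R) ^ n"
    using cutoff_bounds[OF assms] by (intro power_mono) auto
  finally show ?thesis .
qed

lemma inverse_cutoff_power_le:
  assumes "R \<ge> 1" "\<theta> \<ge> 0" "\<eta> \<le> \<theta> * n"
  shows "1 / real (cutoff \<theta> R) ^ n \<le> R powr - \<eta>"
proof -
  have "R powr \<eta> \<le> R powr (\<theta> * n)" using assms by (intro powr_mono) auto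
  also have "\<dots> \<le> real (cutoff \<theta> R) ^ n" by (rule powr_le_cutoff_power[OF assms(1,2)])
  finally have "1 / real (cutoff \<theta> R) ^ n \<le> 1 / R powr \<eta>"
    using assms by (intro divide_left_mono) (auto intro!: mult_pos_pos
      simp: less_le_trans[OF zero_less_one cutoff_bounds(3)[OF assms(1,2)]] )
  then show ?thesis by (simp add: powr_minus_divide)
qed

lemma pair_frequency_error_bound:
  fixes R c g b :: real
  assumes "R > 0" "\<bar>c - 2 * R * g\<bar> \<le> b"
  shows "\<bar>c / (2 * R) - g\<bar> \<le> b / (2 * R)"
proof -
  have "c / (2 * R) - g = (c - 2 * R * g) / (2 * R)" using assms by (simp add: field_simps)
  then have "\<bar>c / (2 * R) - g\<bar> = \<bar>c - 2 * R * g\<bar> / (2 * R)" using assms by (simp add: abs_divide)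
  also have "\<dots> \<le> b / (2 * R)" using assms by (intro divide_right_mono) auto
  finally show ?thesis .
qed

text \<open>With \<open>t = 1 / k\<close> the cutoffs are $D \approx R^t$ and $Y \approx R^{t(1-t)}$. The tail is
  $Y^{1-k} \approx R^{-(1-t)^2}$ because \<open>t * (k - 1) = 1 - t\<close>, and the relative rounding error is
  $D Y / R \approx R^{t + t(1-t) - 1} = R^{-(1-t)^2}$. In the constant the three terms belong to the
  tail, to the rounding and to the distance of the truncated double series from its limit.\<close>
lemma pair_frequency_rate_nonzero:
  assumes k: "k \<ge> 2" and a: "a \<noteq> 0" and R: "R \<ge> max 1 \<bar>real_of_int a\<bar>"
  defines "\<eta> \<equiv> (1 - 1 / real k)\<^sup>2"
  shows "\<bar>Re (weight k a) - card (pair_window k a R) / (2 * R)\<bar> \<le>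
    (1 + 2 * (\<bar>real_of_int a\<bar> + 3) + 4 * \<bar>real_of_int a\<bar>) * R powr - \<eta>"
proof -
  define A where "A = \<bar>real_of_int a\<bar>"
  define t where "t = 1 / real k"
  have t: "0 < t" "t < 1" "t * real k = 1" using k by (auto simp: t_def)
  have kt: "t * real (k - 1) = 1 - t" using k t(3) by (simp add: of_nat_diff algebra_simps)
  have \<eta>: "\<eta> = (1 - t) * (1 - t)" by (simp add: \<eta>_def t_def power2_eq_square)
  have \<eta>0: "\<eta> > 0" using t by (simp add: \<eta>)
  define \<theta> where "\<theta> = t * (1 - t)"
  have \<theta>: "\<theta> \<ge> 0" using t by (simp add: \<theta>_def)
  have \<theta>k: "\<theta> * real (k - 1) = \<eta>"
  proof -
    have "\<theta> * real (k - 1) = (t * real (k - 1)) * (1 - t)" by (simp add: \<theta>_def)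
    then show ?thesis by (simp only: kt \<eta>)
  qed
  have \<eta>t: "\<eta> \<le> t * real (k - 1)" using t unfolding kt \<eta> by (simp add: mult_left_le)
  define D where "D = cutoff t"
  define Y where "Y = cutoff \<theta>"
  have R1: "1 \<le> R" if "max 1 A \<le> R" for R using that by simp
  have DY: "1 \<le> D R" "1 \<le> Y R" "1 / real (D R) ^ (k - 1) \<le> R powr - \<eta>"
      "1 / real (Y R) ^ (k - 1) \<le> R powr - \<eta>" if "max 1 A \<le> R" for R
  proof -
    have "0 \<le> t" "\<eta> \<le> \<theta> * real (k - 1)" using t \<theta>k by auto
    then show "1 \<le> D R" "1 \<le> Y R" "1 / real (D R) ^ (k - 1) \<le> R powr - \<eta>"
      "1 / real (Y R) ^ (k - 1) \<le> R powr - \<eta>"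
      using R1[OF that] \<theta> \<eta>t unfolding D_def Y_def
      by (blast intro: cutoff_bounds(3) inverse_cutoff_power_le)+
  qed
  have "\<bar>Re (weight k a) - card (pair_window k a R) / (2 * R)\<bar> \<le>
      ((1 + 2 * (A + 3)) + 4 * A) * R powr - \<eta>"
  proof (rule rate_from_cauchy_approximation[OF pair_frequency_tendsto_weight[OF k] \<eta>0,
        where G = "\<lambda>R. density_sum k a (D R) (Y R)" and ?R0.0 = "max 1 A"])
    fix R assume "max 1 A \<le> R"
    note this[THEN R1] and dy = DY[OF this] and RA = this
    have "R powr 1 \<le> real (D R) ^ k"
      using powr_le_cutoff_power[of R t k] \<open>1 \<le> R\<close> t by (simp add: D_def)
    then have RD: "R \<le> real (D R) ^ k" using \<open>1 \<le> R\<close> by simp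
    have "\<bar>card (pair_window k a R) - 2 * R * density_sum k a (D R) (Y R)\<bar> \<le>
        2 * R / real (Y R) ^ (k - 1) + (A + 3) * real (D R * Y R)"
      unfolding A_def by (rule pair_count_error[OF k]) (use RA RD dy in \<open>auto simp: A_def\<close>)
    from pair_frequency_error_bound[OF _ this]
    have "\<bar>card (pair_window k a R) / (2 * R) - density_sum k a (D R) (Y R)\<bar> \<le>
        (2 * R / real (Y R) ^ (k - 1) + (A + 3) * real (D R * Y R)) / (2 * R)"
      using \<open>1 \<le> R\<close> by simp
    also have "\<dots> = 1 / real (Y R) ^ (k - 1) + (A + 3) * (real (D R * Y R) / (2 * R))"
      using \<open>1 \<le> R\<close> by (simp add: add_divide_distrib)
    also have "\<dots> \<le> R powr - \<eta> + (A + 3) * (2 * R powr - \<eta>)"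
    proof (intro add_mono mult_left_mono dy(4))
      have "real (D R * Y R) \<le> (2 * R powr t) * (2 * R powr \<theta>)"
        unfolding D_def Y_def of_nat_mult
        using \<open>1 \<le> R\<close> t \<theta> by (intro mult_mono cutoff_bounds) auto
      also have "\<dots> = 4 * R powr (1 - \<eta>)"
      proof -
        have "t + \<theta> = 1 - \<eta>" by (simp add: \<theta>_def \<eta> algebra_simps)
        then show ?thesis by (simp add: powr_add[symmetric])
      qed
      also have "\<dots> = 4 * R * R powr - \<eta>"
        using \<open>1 \<le> R\<close> by (simp add: powr_diff powr_minus_divide)
      finally show "real (D R * Y R) / (2 * R) \<le> 2 * R powr - \<eta>"
        using \<open>1 \<le> R\<close> by (simp add: divide_le_eq mult_ac)
    qed (simp add: A_def)
    also have "\<dots> = (1 + 2 * (A + 3)) * R powr - \<eta>" by (simp add: algebra_simps)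
    finally show "\<bar>card (pair_window k a R) / (2 * R) - density_sum k a (D R) (Y R)\<bar> \<le>
      (1 + 2 * (A + 3)) * R powr - \<eta>" .
  next
    fix R R' assume RR: "max 1 A \<le> R" "R \<le> R'"
    note dy = DY[OF RR(1)]
    have "\<bar>density_sum k a (D R') (Y R') - density_sum k a (D R) (Y R)\<bar> \<le>
        2 * A * (1 / real (D R) ^ (k - 1) + 1 / real (Y R) ^ (k - 1))"
      unfolding A_def using RR t \<theta> dy
      by (intro density_sum_cauchy[OF k a]) (auto simp: D_def Y_def intro!: cutoff_mono)
    also have "\<dots> \<le> 2 * A * (R powr - \<eta> + R powr - \<eta>)"
      using dy by (intro mult_left_mono add_mono) (auto simp: A_def)
    also have "\<dots> = 4 * A * R powr - \<eta>" by simp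
    finally show "\<bar>density_sum k a (D R') (Y R') - density_sum k a (D R) (Y R)\<bar> \<le>
      4 * A * R powr - \<eta>" .
  qed (use R in \<open>simp add: A_def\<close>)
  then show ?thesis by (simp add: A_def)
qed

text \<open>The cutoff is $D \approx R^{1/k}$. The constant \<open>3\<close> comes from rounding in the \<open>D\<close> residue classes,
  the constant \<open>1\<close> from the tail of the Moebius series beyond \<open>D\<close>.\<close>
lemma pair_frequency_rate_zero:
  assumes k: "k \<ge> 2" and R: "R \<ge> 1"
  defines "\<eta> \<equiv> 1 - 1 / real k"
  shows "\<bar>Re (weight k 0) - card (pair_window k 0 R) / (2 * R)\<bar> \<le> (3 + 1) * R powr - \<eta>"
proof -
  define t where "t = 1 / real k"
  have t: "0 < t" "t < 1" "t * real k = 1" using k by (auto simp: t_def)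
  have kt: "t * real (k - 1) = 1 - t" using k t(3) by (simp add: of_nat_diff algebra_simps)
  have \<eta>: "\<eta> = 1 - t" by (simp add: \<eta>_def t_def)
  have \<eta>0: "\<eta> > 0" using t by (simp add: \<eta>)
  define D where "D = cutoff t"
  show ?thesis
  proof (rule rate_from_cauchy_approximation[OF pair_frequency_tendsto_weight[OF k] \<eta>0,
        where G = "\<lambda>R. density_sum k 0 (D R) 1" and ?R0.0 = 1])
    fix R :: real assume R: "1 \<le> R"
    have "R powr 1 \<le> real (D R) ^ k"
      using powr_le_cutoff_power[of R t k] R t by (simp add: D_def)
    then have RD: "R \<le> real (D R) ^ k" using R by simp
    have "\<bar>card (pair_window k 0 R) - 2 * R * density_sum k 0 (D R) 1\<bar> \<le> 3 * real (D R)"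
      by (rule pair_count_error_0) (use k R RD in auto)
    from pair_frequency_error_bound[OF _ this]
    have "\<bar>card (pair_window k 0 R) / (2 * R) - density_sum k 0 (D R) 1\<bar> \<le> 3 * real (D R) / (2 * R)"
      using R by simp
    also have "\<dots> \<le> 3 * (2 * R powr t) / (2 * R)"
      using cutoff_bounds(2)[of R t] R t by (intro divide_right_mono) (auto simp: D_def)
    also have "\<dots> = 3 * R powr (t - 1)" using R by (simp add: powr_diff)
    finally show "\<bar>card (pair_window k 0 R) / (2 * R) - density_sum k 0 (D R) 1\<bar> \<le> 3 * R powr - \<eta>"
      by (simp add: \<eta>)
  next
    fix R R' :: real assume RR: "1 \<le> R" "R \<le> R'"
    have "\<bar>density_sum k 0 (D R') 1 - density_sum k 0 (D R) 1\<bar> \<le> 1 / real (D R) ^ (k - 1)"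
      by (rule density_sum_cauchy_0[OF k])
        (use RR t cutoff_bounds(3)[of R t] cutoff_mono[of R R' t] in \<open>auto simp: D_def\<close>)
    also have "\<dots> \<le> R powr - \<eta>"
      unfolding D_def
      using inverse_cutoff_power_le[of R t \<eta> "k - 1"] RR t by (simp only: kt \<eta> less_imp_le order_refl)
    finally show "\<bar>density_sum k 0 (D R') 1 - density_sum k 0 (D R) 1\<bar> \<le> 1 * R powr - \<eta>" by simp
  qed (rule R)
qed

lemma pair_frequency_rate:
  assumes k: "k \<ge> 2"
  shows "(\<lambda>R. Re (weight k a) - card (pair_window k a R) / (2 * R))
    \<in> O[at_top](\<lambda>R. R powr - ((1 - 1 / real k)\<^sup>2))"
proof (cases "a = 0")
  case True
  have "R powr - (1 - 1 / real k) \<le> R powr - ((1 - 1 / real k)\<^sup>2)" if "R \<ge> 1" for R :: real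
  proof (rule powr_mono)
    have "0 \<le> 1 - 1 / real k" "1 - 1 / real k \<le> 1" using k by auto
    then show "- (1 - 1 / real k) \<le> - ((1 - 1 / real k)\<^sup>2)"
      using mult_left_le[of "1 - 1 / real k" "1 - 1 / real k"] unfolding power2_eq_square by linarith
  qed (rule that)
  then have "\<bar>Re (weight k a) - card (pair_window k a R) / (2 * R)\<bar> \<le> 4 * R powr - ((1 - 1 / real k)\<^sup>2)"
    if "R \<ge> 1" for R
    using pair_frequency_rate_zero[OF k that] that True by (auto intro: order_trans)
  then show ?thesis
    by (intro bigoI[of _ 4] eventually_mono[OF eventually_ge_at_top[of 1]]) auto
next
  case False
  show ?thesis
    by (rule bigoI, rule eventually_mono[OF eventually_ge_at_top[of "max 1 \<bar>real_of_int a\<bar>"]])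
      (use pair_frequency_rate_nonzero[OF k False] in auto)
qed

section \<open>Distributions on the integers with bounded weights\<close>

lemma schwartzD:
  assumes "\<phi> \<in> schwartz"
  shows "nth_vderiv n \<phi> differentiable (at x)"
    "bdd_above (range (\<lambda>x. \<bar>x\<bar> ^ m * cmod (nth_vderiv n \<phi> x)))"
  using assms by (simp_all add: schwartz_def)

lemma nth_vderiv_lincomb:
  assumes "\<phi> \<in> schwartz" "\<psi> \<in> schwartz"
  shows "nth_vderiv n (\<lambda>x. c * \<phi> x + d * \<psi> x) = (\<lambda>x. c * nth_vderiv n \<phi> x + d * nth_vderiv n \<psi> x)"
proof (induction n)
  case (Suc n)
  have diff: "nth_vderiv n \<phi> differentiable (at x)" "nth_vderiv n \<psi> differentiable (at x)" for x
    by (rule schwartzD(1)[OF assms(1)], rule schwartzD(1)[OF assms(2)])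
  have "vector_derivative (\<lambda>x. c * nth_vderiv n \<phi> x + d * nth_vderiv n \<psi> x) (at x) =
      c * vector_derivative (nth_vderiv n \<phi>) (at x) + d * vector_derivative (nth_vderiv n \<psi>) (at x)" for x
    using diff by (intro vector_derivative_at has_vector_derivative_add has_vector_derivative_mult_right)
      (auto simp: vector_derivative_works[symmetric])
  then show ?case using Suc by simp
qed simp

lemma schwartz_lincomb:
  assumes "\<phi> \<in> schwartz" "\<psi> \<in> schwartz"
  shows "(\<lambda>x. c * \<phi> x + d * \<psi> x) \<in> schwartz"
  unfolding schwartz_def mem_Collect_eq nth_vderiv_lincomb[OF assms]
proof (intro conjI allI)
  fix n x
  have "nth_vderiv n \<phi> differentiable (at x)" "nth_vderiv n \<psi> differentiable (at x)"
    by (rule schwartzD(1)[OF assms(1)], rule schwartzD(1)[OF assms(2)])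
  then show "(\<lambda>x. c * nth_vderiv n \<phi> x + d * nth_vderiv n \<psi> x) differentiable (at x)"
    by (intro differentiable_add differentiable_mult differentiable_const)
next
  fix m n
  have "bdd_above (range (\<lambda>x. \<bar>x\<bar> ^ m * cmod (nth_vderiv n \<phi> x)))"
    "bdd_above (range (\<lambda>x. \<bar>x\<bar> ^ m * cmod (nth_vderiv n \<psi> x)))"
    by (rule schwartzD(2)[OF assms(1)], rule schwartzD(2)[OF assms(2)])
  then obtain M N where M: "\<And>x. \<bar>x\<bar> ^ m * cmod (nth_vderiv n \<phi> x) \<le> M"
    and N: "\<And>x. \<bar>x\<bar> ^ m * cmod (nth_vderiv n \<psi> x) \<le> N"
    unfolding bdd_above_def by blast
  show "bdd_above (range (\<lambda>x. \<bar>x\<bar> ^ m * cmod (c * nth_vderiv n \<phi> x + d * nth_vderiv n \<psi> x)))"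
  proof (rule bdd_aboveI2)
    fix x :: real
    have "\<bar>x\<bar> ^ m * cmod (c * nth_vderiv n \<phi> x + d * nth_vderiv n \<psi> x) \<le>
        \<bar>x\<bar> ^ m * (cmod c * cmod (nth_vderiv n \<phi> x) + cmod d * cmod (nth_vderiv n \<psi> x))"
      by (intro mult_left_mono) (auto intro: order_trans[OF norm_triangle_ineq] simp: norm_mult)
    also have "\<dots> = cmod c * (\<bar>x\<bar> ^ m * cmod (nth_vderiv n \<phi> x)) + cmod d * (\<bar>x\<bar> ^ m * cmod (nth_vderiv n \<psi> x))"
      by (simp only: distrib_left mult_ac)
    also have "\<dots> \<le> cmod c * M + cmod d * N"
      by (intro add_mono mult_left_mono M N) auto
    finally show "\<bar>x\<bar> ^ m * cmod (c * nth_vderiv n \<phi> x + d * nth_vderiv n \<psi> x) \<le> cmod c * M + cmod d * N" .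
  qed
qed

text \<open>The two seminorms control \<open>1\<close> and $x^2$ times the function; their sum gives a decay that is
  summable over the integers.\<close>
lemma schwartz_decay:
  assumes "\<rho> \<in> schwartz"
  shows "cmod (\<rho> x) \<le> (schwartz_seminorm 0 0 \<rho> + schwartz_seminorm 2 0 \<rho>) * (1 / (1 + x\<^sup>2))"
proof -
  have bdd: "bdd_above (range (\<lambda>x. \<bar>x\<bar> ^ m * cmod (nth_vderiv 0 \<rho> x)))" for m
    by (rule schwartzD(2)[OF assms])
  have "\<bar>x\<bar> ^ m * cmod (nth_vderiv 0 \<rho> x) \<le> schwartz_seminorm m 0 \<rho>" for m
    unfolding schwartz_seminorm_def by (rule cSUP_upper[OF UNIV_I bdd])
  from this[of 0] this[of 2] have "(1 + x\<^sup>2) * cmod (\<rho> x) \<le> schwartz_seminorm 0 0 \<rho> + schwartz_seminorm 2 0 \<rho>"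
    by (simp add: distrib_right)
  moreover have "1 + x\<^sup>2 > 0" by (simp add: add_pos_nonneg)
  ultimately show ?thesis by (simp add: field_simps)
qed

lemma schwartz_seminorm_zero: "schwartz_seminorm m 0 (\<lambda>x. 0) = 0"
  by (simp add: schwartz_seminorm_def)

lemma summable_on_int_inverse_square: "(\<lambda>a::int. 1 / (1 + (real_of_int a)\<^sup>2)) summable_on UNIV"
proof -
  let ?h = "\<lambda>a::int. 1 / (1 + (real_of_int a)\<^sup>2)"
  have "summable (\<lambda>n. 1 / (1 + (real n)\<^sup>2))"
  proof (rule summable_comparison_test'[of _ 1])
    show "summable (\<lambda>n. inverse (real n ^ 2))" by (rule inverse_power_summable) simp
  qed (auto simp: field_simps add_pos_nonneg)
  then have nat: "(\<lambda>n::nat. 1 / (1 + (real n)\<^sup>2)) summable_on UNIV"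
    by (subst summable_on_UNIV_nonneg_real_iff) auto
  have "?h summable_on (range int)" "?h summable_on (range (\<lambda>n. - int n))"
    using nat by (auto simp: summable_on_reindex inj_on_def o_def)
  then have "?h summable_on (range int \<union> range (\<lambda>n. - int n))"
    by (rule summable_on_union)
  moreover have "range int \<union> range (\<lambda>n. - int n) = UNIV"
  proof -
    have "a \<in> range int \<union> range (\<lambda>n. - int n)" for a :: int
      by (cases a rule: int_cases2) auto
    then show ?thesis by blast
  qed
  ultimately show ?thesis by simp
qed

definition lattice_distribution :: "(int \<Rightarrow> complex) \<Rightarrow> (real \<Rightarrow> complex) \<Rightarrow> complex" where
  "lattice_distribution c = (\<lambda>\<phi>\<in>schwartz. \<Sum>\<^sub>\<infinity>a. c a * \<phi> (real_of_int a))"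

lemma lattice_distribution_term_bound:
  assumes "\<phi> \<in> schwartz" "cmod (c a) \<le> B"
  shows "cmod (c a * \<phi> (real_of_int a)) \<le>
    B * ((schwartz_seminorm 0 0 \<phi> + schwartz_seminorm 2 0 \<phi>) * (1 / (1 + (real_of_int a)\<^sup>2)))"
  unfolding norm_mult using assms schwartz_decay[OF assms(1)]
  by (intro mult_mono) (auto intro: order_trans[OF norm_ge_zero])

lemma lattice_distribution_summable:
  assumes "\<phi> \<in> schwartz" "\<And>a. cmod (c a) \<le> B"
  shows "(\<lambda>a. norm (c a * \<phi> (real_of_int a))) summable_on UNIV"
    "(\<lambda>a. c a * \<phi> (real_of_int a)) summable_on UNIV"
proof -
  show *: "(\<lambda>a. norm (c a * \<phi> (real_of_int a))) summable_on UNIV"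
    by (rule Infinite_Sum.abs_summable_on_comparison_test'[OF _ lattice_distribution_term_bound[where c = c, OF assms]])
      (intro summable_on_cmult_right summable_on_int_inverse_square)
  show "(\<lambda>a. c a * \<phi> (real_of_int a)) summable_on UNIV"
    by (rule abs_summable_summable[OF *])
qed

lemma cmod_lattice_distribution_le:
  assumes "\<phi> \<in> schwartz" "\<And>a. cmod (c a) \<le> B"
  shows "cmod (lattice_distribution c \<phi>) \<le> B * ((schwartz_seminorm 0 0 \<phi> + schwartz_seminorm 2 0 \<phi>) *
    (\<Sum>\<^sub>\<infinity>a::int. 1 / (1 + (real_of_int a)\<^sup>2)))"
proof -
  have "((\<lambda>a. c a * \<phi> (real_of_int a)) has_sum lattice_distribution c \<phi>) UNIV"
    using lattice_distribution_summable(2)[OF assms] assms(1)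
    by (simp add: lattice_distribution_def has_sum_infsum)
  moreover have "((\<lambda>a. B * ((schwartz_seminorm 0 0 \<phi> + schwartz_seminorm 2 0 \<phi>) * (1 / (1 + (real_of_int a)\<^sup>2))))
    has_sum B * ((schwartz_seminorm 0 0 \<phi> + schwartz_seminorm 2 0 \<phi>) *
      (\<Sum>\<^sub>\<infinity>a::int. 1 / (1 + (real_of_int a)\<^sup>2)))) UNIV"
    by (intro has_sum_cmult_right has_sum_infsum summable_on_int_inverse_square)
  ultimately show ?thesis
    by (rule norm_infsum_le) (rule lattice_distribution_term_bound[where c = c, OF assms])
qed

lemma lattice_distribution_lincomb:
  assumes "\<phi> \<in> schwartz" "\<psi> \<in> schwartz" "\<And>a. cmod (c a) \<le> B"
  shows "lattice_distribution c (\<lambda>x. u * \<phi> x + v * \<psi> x) =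
    u * lattice_distribution c \<phi> + v * lattice_distribution c \<psi>"
proof -
  have "(\<Sum>\<^sub>\<infinity>a. c a * (u * \<phi> (real_of_int a) + v * \<psi> (real_of_int a))) =
      (\<Sum>\<^sub>\<infinity>a. u * (c a * \<phi> (real_of_int a)) + v * (c a * \<psi> (real_of_int a)))"
    by (simp add: algebra_simps)
  also have "\<dots> = u * (\<Sum>\<^sub>\<infinity>a. c a * \<phi> (real_of_int a)) + v * (\<Sum>\<^sub>\<infinity>a. c a * \<psi> (real_of_int a))"
    using lattice_distribution_summable(2)[OF assms(1,3)] lattice_distribution_summable(2)[OF assms(2,3)]
    by (subst infsum_add) (auto intro: summable_on_cmult_right simp: infsum_cmult_right)
  finally show ?thesis
    using assms schwartz_lincomb[OF assms(1,2)] by (simp add: lattice_distribution_def)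
qed

lemma topspace_schwartz_topology: "topspace schwartz_topology = schwartz"
proof -
  have "{\<psi> \<in> schwartz. schwartz_seminorm 0 0 (\<lambda>x. \<psi> x - \<phi> x) < 1} \<in>
      {{\<psi> \<in> schwartz. schwartz_seminorm m n (\<lambda>x. \<psi> x - \<phi> x) < e} | m n \<phi> e. \<phi> \<in> schwartz \<and> e > 0}"
    if "\<phi> \<in> schwartz" for \<phi>
    using that by (intro CollectI exI[of _ 0] exI[of _ \<phi>] exI[of _ "1::real"]) auto
  moreover have "\<phi> \<in> {\<psi> \<in> schwartz. schwartz_seminorm 0 0 (\<lambda>x. \<psi> x - \<phi> x) < 1}"
    if "\<phi> \<in> schwartz" for \<phi>
    using that by (simp add: schwartz_seminorm_zero)
  ultimately have "schwartz \<subseteq> topspace schwartz_topology"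
    unfolding schwartz_topology_def topology_generated_by_topspace by (intro subsetI UnionI)
  moreover have "topspace schwartz_topology \<subseteq> schwartz"
    unfolding schwartz_topology_def topology_generated_by_topspace by (rule Union_least) auto
  ultimately show ?thesis by (intro equalityI)
qed

lemma openin_schwartz_ball:
  assumes "\<phi> \<in> schwartz" "e > 0"
  shows "openin schwartz_topology {\<psi> \<in> schwartz. schwartz_seminorm m n (\<lambda>x. \<psi> x - \<phi> x) < e}"
  unfolding schwartz_topology_def using assms by (intro topology_generated_by_Basis) blast

text \<open>A linear functional bounded by finitely many of the defining seminorms is continuous;
  here two of them suffice.\<close>
lemma lattice_distribution_continuous:
  assumes "\<And>a. cmod (c a) \<le> B"
  shows "continuous_map schwartz_topology euclidean (lattice_distribution c)"
  unfolding continuous_map_def topspace_schwartz_topology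
proof (intro conjI allI impI)
  fix U :: "complex set" assume "openin euclidean U"
  then have U: "open U" by simp
  define Z where "Z = B * (\<Sum>\<^sub>\<infinity>a::int. 1 / (1 + (real_of_int a)\<^sup>2))"
  have "B \<ge> 0" using assms[of 0] norm_ge_zero order_trans by blast
  then have Z: "Z \<ge> 0" unfolding Z_def by (intro mult_nonneg_nonneg infsum_nonneg) auto
  show "openin schwartz_topology {\<phi> \<in> schwartz. lattice_distribution c \<phi> \<in> U}"
  proof (subst openin_subopen, intro ballI)
    fix \<phi> assume \<phi>: "\<phi> \<in> {\<phi> \<in> schwartz. lattice_distribution c \<phi> \<in> U}"
    then obtain e where e: "e > 0" "ball (lattice_distribution c \<phi>) e \<subseteq> U"
      using U by (auto simp: open_contains_ball)
    define \<delta> where "\<delta> = e / (2 * (Z + 1))"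
    have \<delta>: "\<delta> > 0" using e Z by (simp add: \<delta>_def)
    define V where "V = (\<lambda>m. {\<psi> \<in> schwartz. schwartz_seminorm m 0 (\<lambda>x. \<psi> x - \<phi> x) < \<delta>})"
    have "openin schwartz_topology (V 0 \<inter> V 2)"
      using \<phi> \<delta> unfolding V_def by (intro openin_Int openin_schwartz_ball) auto
    moreover have "\<phi> \<in> V 0 \<inter> V 2"
      using \<phi> \<delta> by (simp add: V_def schwartz_seminorm_zero)
    moreover have "lattice_distribution c \<psi> \<in> U" if \<psi>: "\<psi> \<in> V 0 \<inter> V 2" for \<psi>
    proof -
      have S: "\<phi> \<in> schwartz" "\<psi> \<in> schwartz" using \<phi> \<psi> by (auto simp: V_def)
      have diff: "(\<lambda>x. \<psi> x - \<phi> x) = (\<lambda>x. 1 * \<psi> x + (- 1) * \<phi> x)" by simp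
      have "(\<lambda>x. \<psi> x - \<phi> x) \<in> schwartz"
        unfolding diff by (rule schwartz_lincomb) (use S in auto)
      then have "cmod (lattice_distribution c (\<lambda>x. \<psi> x - \<phi> x)) \<le> B *
          ((schwartz_seminorm 0 0 (\<lambda>x. \<psi> x - \<phi> x) + schwartz_seminorm 2 0 (\<lambda>x. \<psi> x - \<phi> x)) *
            (\<Sum>\<^sub>\<infinity>a::int. 1 / (1 + (real_of_int a)\<^sup>2)))"
        by (rule cmod_lattice_distribution_le[OF _ assms])
      also have "\<dots> = (schwartz_seminorm 0 0 (\<lambda>x. \<psi> x - \<phi> x) + schwartz_seminorm 2 0 (\<lambda>x. \<psi> x - \<phi> x)) * Z"
        unfolding Z_def by (rule mult.left_commute)
      also have "\<dots> \<le> (\<delta> + \<delta>) * Z"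
        using \<psi> Z by (intro mult_right_mono add_mono) (auto simp: V_def)
      also have "\<dots> < (\<delta> + \<delta>) * (Z + 1)" using \<delta> by simp
      also have "\<dots> = 2 * (Z + 1) * \<delta>" by (simp add: algebra_simps)
      also have "\<dots> = e" using Z unfolding \<delta>_def by simp
      finally have "cmod (lattice_distribution c \<psi> - lattice_distribution c \<phi>) < e"
        unfolding diff lattice_distribution_lincomb[where c = c, OF S(2,1) assms] by simp
      then have "lattice_distribution c \<psi> \<in> ball (lattice_distribution c \<phi>) e"
        by (simp add: dist_norm norm_minus_commute)
      with e show ?thesis by blast
    qed
    ultimately show "\<exists>T. openin schwartz_topology T \<and> \<phi> \<in> T \<and>
        T \<subseteq> {\<phi> \<in> schwartz. lattice_distribution c \<phi> \<in> U}"
      by (intro exI[of _ "V 0 \<inter> V 2"]) (auto simp: V_def)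
  qed
qed auto

lemma lattice_distribution_tempered:
  assumes "\<And>a. cmod (c a) \<le> B"
  shows "lattice_distribution c \<in> tempered_distributions"
proof -
  have "lattice_distribution c (\<lambda>x. \<phi> x + \<psi> x) = lattice_distribution c \<phi> + lattice_distribution c \<psi>"
    if "\<phi> \<in> schwartz" "\<psi> \<in> schwartz" for \<phi> \<psi>
    using lattice_distribution_lincomb[where c = c and u = 1 and v = 1, OF that assms] by simp
  moreover have "lattice_distribution c (\<lambda>x. u * \<phi> x) = u * lattice_distribution c \<phi>"
    if "\<phi> \<in> schwartz" for \<phi> u
    using lattice_distribution_lincomb[where c = c and u = u and v = 0, OF that that assms] by simp
  moreover have "lattice_distribution c \<in> extensional schwartz"
    by (simp add: lattice_distribution_def)
  ultimately show ?thesis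
    using lattice_distribution_continuous[of c B] assms by (simp add: tempered_distributions_def)
qed

text \<open>Dominated convergence: the bounds on the coefficients make the partial sums converge
  uniformly in the parameter, so limit and sum may be exchanged.\<close>
lemma lattice_distribution_tendsto:
  fixes c :: "real \<Rightarrow> int \<Rightarrow> complex"
  assumes "\<phi> \<in> schwartz"
    and bound: "\<And>R a. R \<ge> R0 \<Longrightarrow> cmod (c R a) \<le> B"
    and lim: "\<And>a. ((\<lambda>R. c R a) \<longlongrightarrow> l a) at_top"
    and bound_lim: "\<And>a. cmod (l a) \<le> B"
  shows "((\<lambda>R. lattice_distribution (c R) \<phi>) \<longlongrightarrow> lattice_distribution l \<phi>) at_top"
proof -
  have "((\<lambda>R. \<Sum>\<^sub>\<infinity>a. c R a * \<phi> (real_of_int a)) \<longlongrightarrow> (\<Sum>\<^sub>\<infinity>a. l a * \<phi> (real_of_int a))) at_top"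
  proof (rule swap_uniform_limit')
    show "\<forall>\<^sub>F X in finite_subsets_at_top UNIV.
      ((\<lambda>R. \<Sum>a\<in>X. c R a * \<phi> (real_of_int a)) \<longlongrightarrow> (\<Sum>a\<in>X. l a * \<phi> (real_of_int a))) at_top"
      by (intro always_eventually allI tendsto_intros lim)
    show "((\<lambda>X. \<Sum>a\<in>X. l a * \<phi> (real_of_int a)) \<longlongrightarrow> (\<Sum>\<^sub>\<infinity>a. l a * \<phi> (real_of_int a)))
        (finite_subsets_at_top UNIV)"
      using has_sum_infsum[OF lattice_distribution_summable(2)[OF assms(1) bound_lim]]
      by (simp add: has_sum_def)
    show "uniform_limit {R0..} (\<lambda>X R. \<Sum>a\<in>X. c R a * \<phi> (real_of_int a))
        (\<lambda>R. \<Sum>\<^sub>\<infinity>a. c R a * \<phi> (real_of_int a)) (finite_subsets_at_top UNIV)"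
      by (rule Weierstrass_m_test_general[where
        M = "\<lambda>a. B * ((schwartz_seminorm 0 0 \<phi> + schwartz_seminorm 2 0 \<phi>) * (1 / (1 + (real_of_int a)\<^sup>2)))"])
        (auto intro!: lattice_distribution_term_bound assms(1) bound
          summable_on_cmult_right summable_on_int_inverse_square simp del: times_divide_eq_right)
    show "\<forall>\<^sub>F R in at_top. R \<in> {R0..}"
      by (auto intro: eventually_mono[OF eventually_ge_at_top[of R0]])
  qed simp
  then show ?thesis using assms(1) by (simp add: lattice_distribution_def)
qed

section \<open>The autocorrelation of the power-free integers\<close>

lemma card_pair_window_le:
  assumes "R \<ge> 1"
  shows "card (pair_window k a R) / (2 * R) \<le> 2"
proof -
  have "card (pair_window k a R) \<le> card {x::int. \<bar>real_of_int x\<bar> < R}"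
    by (intro card_mono) (auto simp: pair_window_def)
  also have "{x::int. \<bar>real_of_int x\<bar> < R} = {x::int. - R < real_of_int x \<and> real_of_int x < R}"
    by (auto simp: abs_less_iff)
  finally have "real (card (pair_window k a R)) \<le> card {x::int. - R < real_of_int x \<and> real_of_int x < R}"
    by simp
  also have "\<dots> \<le> 2 * R + 1"
    using card_open_interval_int[of "- R" R] assms by simp
  also have "\<dots> \<le> 2 * (2 * R)" using assms by simp
  finally show ?thesis using assms by (simp add: divide_le_eq)
qed

lemma cmod_weight_le:
  assumes "k \<ge> 2"
  shows "cmod (weight k a) \<le> 2"
proof -
  have "0 \<le> Re (weight k a)"
    by (rule tendsto_lowerbound[OF pair_frequency_tendsto_weight[OF assms]])
      (auto intro!: eventually_mono[OF eventually_ge_at_top[of 0]])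
  moreover have "Re (weight k a) \<le> 2"
    by (rule tendsto_upperbound[OF pair_frequency_tendsto_weight[OF assms]])
      (use card_pair_window_le in \<open>auto intro!: eventually_mono[OF eventually_ge_at_top[of 1]]\<close>)
  ultimately show ?thesis
    by (subst weight_eq_of_real[OF assms]) (simp only: norm_of_real abs_of_nonneg)
qed

text \<open>Grouping the pairs \<open>(x, y)\<close> by their difference turns the double sum over the window into
  a single sum over the differences.\<close>
lemma truncated_autocorrelation_eq:
  "truncated_autocorrelation (real_of_int ` power_free k) R =
   lattice_distribution (\<lambda>a. complex_of_real (card (pair_window k a R) / (2 * R)))"
proof (rule ext)
  fix \<phi> :: "real \<Rightarrow> complex"
  define W where "W = {x \<in> power_free k. \<bar>real_of_int x\<bar> < R}"
  have fin: "finite W"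
    by (rule finite_subset[OF _ finite_bounded_int[of R]]) (auto simp: W_def)
  show "truncated_autocorrelation (real_of_int ` power_free k) R \<phi> =
    lattice_distribution (\<lambda>a. complex_of_real (card (pair_window k a R) / (2 * R))) \<phi>"
  proof (cases "\<phi> \<in> schwartz")
    case True
    define T where "T = (\<lambda>(x, y). x - y) ` (W \<times> W)"
    have count: "card {p \<in> W \<times> W. (case p of (x, y) \<Rightarrow> x - y) = a} = card (pair_window k a R)" for a
    proof -
      have "bij_betw fst {p \<in> W \<times> W. (case p of (x, y) \<Rightarrow> x - y) = a} (pair_window k a R)"
        by (rule bij_betw_byWitness[of _ "\<lambda>x. (x, x - a)"]) (auto simp: W_def pair_window_def)
      then show ?thesis by (rule bij_betw_same_card)
    qed
    have zero: "card (pair_window k a R) = 0" if "a \<notin> T" for a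
    proof -
      have "{p \<in> W \<times> W. (case p of (x, y) \<Rightarrow> x - y) = a} = {}" using that by (auto simp: T_def)
      then show ?thesis using count[of a] by (simp only: card.empty)
    qed
    have "{x \<in> real_of_int ` power_free k. \<bar>x\<bar> < R} = real_of_int ` W" by (auto simp: W_def)
    then have "(\<Sum>x\<in>{x \<in> real_of_int ` power_free k. \<bar>x\<bar> < R}. \<Sum>y\<in>{y \<in> real_of_int ` power_free k. \<bar>y\<bar> < R}.
        dirac (x - y) \<phi>) = (\<Sum>x\<in>W. \<Sum>y\<in>W. \<phi> (real_of_int (x - y)))"
      using True by (simp add: sum.reindex inj_on_def dirac_def)
    also have "\<dots> = (\<Sum>p\<in>W \<times> W. \<phi> (real_of_int (case p of (x, y) \<Rightarrow> x - y)))"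
      by (simp add: sum.cartesian_product case_prod_unfold)
    also have "\<dots> = (\<Sum>a\<in>T. \<Sum>p\<in>{p \<in> W \<times> W. (case p of (x, y) \<Rightarrow> x - y) = a}.
        \<phi> (real_of_int (case p of (x, y) \<Rightarrow> x - y)))"
      using fin by (intro sum.group[symmetric]) (auto simp: T_def)
    also have "\<dots> = (\<Sum>a\<in>T. of_nat (card (pair_window k a R)) * \<phi> (real_of_int a))"
    proof (rule sum.cong)
      fix a
      have "(\<Sum>p\<in>{p \<in> W \<times> W. (case p of (x, y) \<Rightarrow> x - y) = a}. \<phi> (real_of_int (case p of (x, y) \<Rightarrow> x - y))) =
          (\<Sum>p\<in>{p \<in> W \<times> W. (case p of (x, y) \<Rightarrow> x - y) = a}. \<phi> (real_of_int a))"
        by (rule sum.cong) auto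
      then show "(\<Sum>p\<in>{p \<in> W \<times> W. (case p of (x, y) \<Rightarrow> x - y) = a}. \<phi> (real_of_int (case p of (x, y) \<Rightarrow> x - y))) =
          of_nat (card (pair_window k a R)) * \<phi> (real_of_int a)"
        by (simp only: sum_constant count)
    qed simp
    finally have eq: "(\<Sum>x\<in>{x \<in> real_of_int ` power_free k. \<bar>x\<bar> < R}.
        \<Sum>y\<in>{y \<in> real_of_int ` power_free k. \<bar>y\<bar> < R}. dirac (x - y) \<phi>) =
        (\<Sum>a\<in>T. of_nat (card (pair_window k a R)) * \<phi> (real_of_int a))" .
    have "truncated_autocorrelation (real_of_int ` power_free k) R \<phi> =
        1 / (2 * of_real R) * (\<Sum>a\<in>T. of_nat (card (pair_window k a R)) * \<phi> (real_of_int a))"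
      unfolding truncated_autocorrelation_def restrict_apply' [OF True] eq by (rule refl)
    also have "\<dots> =
        (\<Sum>a\<in>T. complex_of_real (card (pair_window k a R) / (2 * R)) * \<phi> (real_of_int a))"
      by (simp add: sum_distrib_left)
    also have "\<dots> = (\<Sum>\<^sub>\<infinity>a\<in>T. complex_of_real (card (pair_window k a R) / (2 * R)) * \<phi> (real_of_int a))"
      using fin by (simp add: T_def)
    also have "\<dots> = (\<Sum>\<^sub>\<infinity>a. complex_of_real (card (pair_window k a R) / (2 * R)) * \<phi> (real_of_int a))"
      by (rule infsum_cong_neutral) (auto simp: zero)
    finally show ?thesis using True by (simp add: lattice_distribution_def)
  qed (simp add: truncated_autocorrelation_def lattice_distribution_def)
qed

lemma uniform_discrete_int_image: "uniform_discrete (real_of_int ` A)"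
  unfolding uniform_discrete_def
proof (intro exI[of _ 1] conjI ballI impI)
  fix x y assume "x \<in> real_of_int ` A" "y \<in> real_of_int ` A" "dist x y < 1"
  then obtain m n where "x = of_int m" "y = of_int n" "\<bar>real_of_int (m - n)\<bar> < 1"
    by (auto simp: dist_real_def)
  moreover from this have "m = n" by linarith
  ultimately show "x = y" by simp
qed simp

lemma power_free_has_autocorrelation:
  assumes k: "k \<ge> 2"
  shows "has_natural_autocorrelation (real_of_int ` power_free k) (lattice_distribution (weight k))"
proof -
  let ?c = "\<lambda>R a. complex_of_real (card (pair_window k a R) / (2 * R))"
  have bound: "cmod (?c R a) \<le> 2" if "R \<ge> 1" for R a
    using card_pair_window_le[OF that, of k a] that by (simp only: norm_of_real) simp
  have lim: "((\<lambda>R. ?c R a) \<longlongrightarrow> weight k a) at_top" for a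
    by (subst weight_eq_of_real[OF k]) (intro tendsto_of_real pair_frequency_tendsto_weight[OF k])
  have "limitin weak_star_topology (\<lambda>R. lattice_distribution (?c R)) (lattice_distribution (weight k)) at_top"
    unfolding weak_star_topology_def limitin_subtopology limitin_componentwise
  proof (intro conjI ballI)
    show "lattice_distribution (weight k) \<in> tempered_distributions"
      by (rule lattice_distribution_tempered) (rule cmod_weight_le[OF k])
    show "\<forall>\<^sub>F R in at_top. lattice_distribution (?c R) \<in> tempered_distributions"
      using lattice_distribution_tempered[OF bound] by (rule eventually_mono[OF eventually_ge_at_top[of 1]])
    show "\<forall>\<^sub>F R in at_top. lattice_distribution (?c R) \<in>
        topspace (product_topology (\<lambda>_. euclidean) schwartz)"
      by (auto simp: lattice_distribution_def)
    fix \<phi> :: "real \<Rightarrow> complex" assume "\<phi> \<in> schwartz"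
    then show "limitin euclidean (\<lambda>R. lattice_distribution (?c R) \<phi>) (lattice_distribution (weight k) \<phi>) at_top"
      unfolding limitin_canonical_iff
      by (rule lattice_distribution_tendsto[OF _ bound lim cmod_weight_le[OF k]])
  qed (simp add: lattice_distribution_def)
  moreover have "truncated_autocorrelation (real_of_int ` power_free k) = (\<lambda>R. lattice_distribution (?c R))"
    by (rule ext) (rule truncated_autocorrelation_eq)
  ultimately show ?thesis
    unfolding has_natural_autocorrelation_def by (simp add: uniform_discrete_int_image)
qed

theorem theorem4:
  fixes k :: nat
  assumes "k \<ge> 2"
  shows "(\<exists>\<gamma>. has_natural_autocorrelation (real_of_int ` power_free k) \<gamma> \<and>
            (\<forall>\<phi>\<in>schwartz. ((\<lambda>a::int. weight k a * dirac (of_int a) \<phi>) has_sum \<gamma> \<phi>) UNIV)) \<and>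
         (\<forall>a::int.
            (\<lambda>R::real. cmod (weight k a -
               1 / (2 * of_real R) *
                 of_nat (card {x \<in> power_free k. x - a \<in> power_free k \<and>
                   \<bar>real_of_int x\<bar> < R \<and> \<bar>real_of_int (x - a)\<bar> < R})))
            \<in> O[at_top](\<lambda>R. R powr (- ((1 - 1 / real k)\<^sup>2))))"
proof (intro conjI allI exI[of _ "lattice_distribution (weight k)"] ballI)
  show "has_natural_autocorrelation (real_of_int ` power_free k) (lattice_distribution (weight k))"
    by (rule power_free_has_autocorrelation[OF assms])
  show "((\<lambda>a::int. weight k a * dirac (of_int a) \<phi>) has_sum lattice_distribution (weight k) \<phi>) UNIV"
    if "\<phi> \<in> schwartz" for \<phi>
    using has_sum_infsum[OF lattice_distribution_summable(2)[OF that cmod_weight_le[OF assms]]] that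
    by (simp add: lattice_distribution_def dirac_def)
next
  fix a :: int
  have "cmod (weight k a - 1 / (2 * of_real R) * of_nat (card (pair_window k a R))) =
      norm (Re (weight k a) - card (pair_window k a R) / (2 * R))" for R
  proof -
    have "weight k a - 1 / (2 * of_real R) * of_nat (card (pair_window k a R)) =
        complex_of_real (Re (weight k a) - card (pair_window k a R) / (2 * R))"
      by (subst weight_eq_of_real[OF assms]) simp
    then show ?thesis by (simp only: norm_of_real real_norm_def)
  qed
  then show "(\<lambda>R::real. cmod (weight k a -
      1 / (2 * of_real R) *
        of_nat (card {x \<in> power_free k. x - a \<in> power_free k \<and>
          \<bar>real_of_int x\<bar> < R \<and> \<bar>real_of_int (x - a)\<bar> < R})))
      \<in> O[at_top](\<lambda>R. R powr (- ((1 - 1 / real k)\<^sup>2)))"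
    using pair_frequency_rate[OF assms, of a]
    by (simp only: pair_window_def[symmetric] real_norm_def landau_o.big.abs_in_iff)
qed

end
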